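(* Let $G$ be a unique product monoid, $I$ an ideal of $R$, and $S=R*G$ a crossed product. If $I$ is $G$-stable, then the following conditions are equivalent. (1) $I$ is right $S$-prime, i.e. $IS$ is a prime ideal of $S$. (2) If $a,b\in R$, $g\in G$, and $aR^g(b^h)^g\subseteq I$ for all $h\in G$, then $a\in I$ or $b^h\in I$ for all $h\in G$. (3) If $A$ is a left ideal of $R$, $B$ is a $G$-stable ideal of $R$, and $AB^g\subseteq I$ for some $g\in G$, then $A\subseteq I$ or $B\subseteq I$. If $R$ is commutative or $\sigma$ is pointwise surjective, then "left ideal" can be replaced by "ideal" in (3).
   Context: Rings have $1$, ideals are two-sided unless stated otherwise. A unique product monoid is a monoid $G$ (identity $e$) such that whenever $X,Y$ are nonempty finite subsets of $G$, there exist $x\in X$, $y\in Y$ with $xy\ne x'y'$ for every pair $(x',y')\in X\times Y$ different from $(x,y)$. A crossed product $S=R*G$ is determined by a ring $R$, a monoid $G$, and functions $\sigma:G\to\operatorname{End}_{\mathrm{Ring}}(R)$ and $c:G\times G\to GL_1(R)$ (units of $R$); write $r^g=\sigma(g)(r)$ and $X^g=\{x^g:x\in X\}$ for $X\subseteq R$. $S=\bigoplus_{g\in G}R\overline{g}$ is a free left $R$-module with basis $\{\overline g:g\in G\}$ and multiplication determined by $\overline g\, r=r^g\,\overline g$ and $\overline g\,\overline h=c(g,h)\overline{gh}$, where for all $r\in R$, $g,h,i\in G$: $r^e=r$; $c(g,e)=c(e,g)=1$; $(r^h)^g c(g,h)=c(g,h)r^{gh}$; $c(g,h)c(gh,i)=c(h,i)^g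 c(g,hi)$. $R$ is identified with $R\overline e$. $\sigma$ is pointwise surjective if $\sigma(g)$ is surjective for all $g\in G$. An ideal $I$ of $R$ is $G$-stable if $I^g\subseteq I$ for all $g\in G$; then $IS$ is an ideal of $S$.
   Formalization: The equivalence of (1) with (2) is stated for I ≠ R only: prime ideals are taken to be proper, and for I = R conditions (2) and (3) hold trivially while IS = S is not prime; the equivalence of (2) and (3) and its "ideal" variant are stated for every I. *)

theory Defs
  imports "HOL-Algebra.Ideal_Product"
begin

locale unique_product_monoid = monoid G for G (structure) +
  assumes unique_product:
    "\<lbrakk>finite X; X \<noteq> {}; X \<subseteq> carrier G; finite Y; Y \<noteq> {}; Y \<subseteq> carrier G\<rbrakk>
      \<Longrightarrow> \<exists>x\<in>X. \<exists>y\<in>Y. \<forall>x'\<in>X. \<forall>y'\<in>Y. (x', y') \<noteq> (x, y) \<longrightarrow> x \<otimes> y \<noteq> x' \<otimes> y'"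

text \<open>The data determining a crossed product \<open>R * G\<close>. The image \<open>r\<^sup>g\<close> is written \<open>\<sigma> g r\<close>;
  elements of \<^term>\<open>ring_hom R R\<close> preserve \<open>1\<close>.\<close>

locale crossed_system = R: ring R + G: monoid G
  for R :: "('r, 'k) ring_scheme" and G :: "('g, 'm) monoid_scheme"
  and \<sigma> :: "'g \<Rightarrow> 'r \<Rightarrow> 'r" and c :: "'g \<Rightarrow> 'g \<Rightarrow> 'r" +
  assumes action_hom: "g \<in> carrier G \<Longrightarrow> \<sigma> g \<in> ring_hom R R"
    and twist_unit: "\<lbrakk>g \<in> carrier G; h \<in> carrier G\<rbrakk> \<Longrightarrow> c g h \<in> Units R"
    and action_one: "r \<in> carrier R \<Longrightarrow> \<sigma> \<one>\<^bsub>G\<^esub> r = r"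
    and twist_one_right: "g \<in> carrier G \<Longrightarrow> c g \<one>\<^bsub>G\<^esub> = \<one>\<^bsub>R\<^esub>"
    and twist_one_left: "g \<in> carrier G \<Longrightarrow> c \<one>\<^bsub>G\<^esub> g = \<one>\<^bsub>R\<^esub>"
    and action_mult: "\<lbrakk>r \<in> carrier R; g \<in> carrier G; h \<in> carrier G\<rbrakk>
      \<Longrightarrow> \<sigma> g (\<sigma> h r) \<otimes>\<^bsub>R\<^esub> c g h = c g h \<otimes>\<^bsub>R\<^esub> \<sigma> (g \<otimes>\<^bsub>G\<^esub> h) r"
    and twist_cocycle: "\<lbrakk>g \<in> carrier G; h \<in> carrier G; i \<in> carrier G\<rbrakk>
      \<Longrightarrow> c g h \<otimes>\<^bsub>R\<^esub> c (g \<otimes>\<^bsub>G\<^esub> h) i = \<sigma> g (c h i) \<otimes>\<^bsub>R\<^esub> c g (h \<otimes>\<^bsub>G\<^esub> i)"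

text \<open>A formal sum \<open>\<Sum> f(g) g\<close> over the basis is represented by its finitely supported coefficient
  function \<open>f\<close>, which is made extensional outside the carrier of \<open>G\<close>.\<close>

definition coeff_support ::
  "('r, 'k) ring_scheme \<Rightarrow> ('g, 'm) monoid_scheme \<Rightarrow> ('g \<Rightarrow> 'r) \<Rightarrow> 'g set"
  where "coeff_support R G f = {g \<in> carrier G. f g \<noteq> \<zero>\<^bsub>R\<^esub>}"

definition cp_monomial ::
  "('r, 'k) ring_scheme \<Rightarrow> ('g, 'm) monoid_scheme \<Rightarrow> 'r \<Rightarrow> 'g \<Rightarrow> ('g \<Rightarrow> 'r)"
  where "cp_monomial R G r g = (\<lambda>k\<in>carrier G. if k = g then r else \<zero>\<^bsub>R\<^esub>)"

text \<open>The product is the biadditive extension of \<open>(r x) (s y) = r s\<^sup>x c(x, y) (x y)\<close>,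
  for \<open>x, y\<close> in the basis; see \<open>cp_monomial_mult\<close> below.\<close>

definition crossed_product ::
  "('r, 'k) ring_scheme \<Rightarrow> ('g, 'm) monoid_scheme \<Rightarrow> ('g \<Rightarrow> 'r \<Rightarrow> 'r) \<Rightarrow> ('g \<Rightarrow> 'g \<Rightarrow> 'r)
    \<Rightarrow> ('g \<Rightarrow> 'r) ring"
  where "crossed_product R G \<sigma> c =
    \<lparr> carrier = {f \<in> carrier G \<rightarrow>\<^sub>E carrier R. finite (coeff_support R G f)},
      mult = (\<lambda>f f'. \<lambda>k\<in>carrier G.
        finsum R (\<lambda>(x, y). f x \<otimes>\<^bsub>R\<^esub> \<sigma> x (f' y) \<otimes>\<^bsub>R\<^esub> c x y)
          {(x, y) \<in> coeff_support R G f \<times> coeff_support R G f'. x \<otimes>\<^bsub>G\<^esub> y = k}),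
      one = cp_monomial R G \<one>\<^bsub>R\<^esub> \<one>\<^bsub>G\<^esub>,
      zero = (\<lambda>k\<in>carrier G. \<zero>\<^bsub>R\<^esub>),
      add = (\<lambda>f f'. \<lambda>k\<in>carrier G. f k \<oplus>\<^bsub>R\<^esub> f' k) \<rparr>"

lemma (in crossed_system) cp_monomial_mult:
  assumes "r \<in> carrier R" "s \<in> carrier R" "g \<in> carrier G" "h \<in> carrier G"
  shows "cp_monomial R G r g \<otimes>\<^bsub>crossed_product R G \<sigma> c\<^esub> cp_monomial R G s h
    = cp_monomial R G (r \<otimes>\<^bsub>R\<^esub> \<sigma> g s \<otimes>\<^bsub>R\<^esub> c g h) (g \<otimes>\<^bsub>G\<^esub> h)"
proof -
  have supp: "coeff_support R G (cp_monomial R G t k) = (if t = \<zero>\<^bsub>R\<^esub> then {} else {k})"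
    if "k \<in> carrier G" for t k
    using that by (auto simp: coeff_support_def cp_monomial_def)
  have c: "c g h \<in> carrier R" using twist_unit assms by auto
  have sg: "\<sigma> g s \<in> carrier R" using action_hom[OF assms(3)] assms(2) by (rule ring_hom_closed)
  have z: "\<sigma> g \<zero>\<^bsub>R\<^esub> = \<zero>\<^bsub>R\<^esub>"
    using ring_hom_zero[OF action_hom[OF assms(3)] R.ring_axioms R.ring_axioms] .
  have m: "r \<otimes>\<^bsub>R\<^esub> \<sigma> g s \<otimes>\<^bsub>R\<^esub> c g h \<in> carrier R" using assms c sg by simp
  show ?thesis
  proof (cases "r = \<zero>\<^bsub>R\<^esub> \<or> s = \<zero>\<^bsub>R\<^esub>")
    case True
    then have "r \<otimes>\<^bsub>R\<^esub> \<sigma> g s \<otimes>\<^bsub>R\<^esub> c g h = \<zero>\<^bsub>R\<^esub>" using assms c sg z by auto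
    with True show ?thesis
      using assms by (auto simp: crossed_product_def supp) (auto simp: cp_monomial_def)
  next
    case False
    have p: "{(x, y). x = g \<and> y = h \<and> x \<otimes>\<^bsub>G\<^esub> y = k}
        = (if k = g \<otimes>\<^bsub>G\<^esub> h then {(g, h)} else {})" for k
      by auto
    from False show ?thesis
      using assms m by (simp add: crossed_product_def supp p)
        (auto simp: cp_monomial_def fun_eq_iff)
  qed
qed

text \<open>Library prime ideals are restricted to commutative rings. For noncommutative rings, a proper
  ideal is prime if it contains a product of two ideals only when it contains one of them.\<close>

definition nc_prime_ideal :: "'a set \<Rightarrow> ('a, 'k) ring_scheme \<Rightarrow> bool"
  where "nc_prime_ideal P S \<longleftrightarrow> ideal P S \<and> P \<noteq> carrier S \<and>
    (\<forall>A B. ideal A S \<and> ideal B S \<and> A \<cdot>\<^bsub>S\<^esub> B \<subseteq> P \<longrightarrow> A \<subseteq> P \<or> B \<subseteq> P)"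

locale left_ideal = additive_subgroup I R + ring R for I and R (structure) +
  assumes left_closed: "\<lbrakk>a \<in> I; x \<in> carrier R\<rbrakk> \<Longrightarrow> x \<otimes> a \<in> I"

definition G_stable :: "('g, 'm) monoid_scheme \<Rightarrow> ('g \<Rightarrow> 'r \<Rightarrow> 'r) \<Rightarrow> 'r set \<Rightarrow> bool"
  where "G_stable G \<sigma> I \<longleftrightarrow> (\<forall>g\<in>carrier G. \<sigma> g ` I \<subseteq> I)"

definition pointwise_surjective ::
  "('r, 'k) ring_scheme \<Rightarrow> ('g, 'm) monoid_scheme \<Rightarrow> ('g \<Rightarrow> 'r \<Rightarrow> 'r) \<Rightarrow> bool"
  where "pointwise_surjective R G \<sigma> \<longleftrightarrow> (\<forall>g\<in>carrier G. \<sigma> g ` carrier R = carrier R)"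

text \<open>\<open>IS\<close>, where \<open>R\<close> is identified with the coefficients at the identity of \<open>G\<close>. The operation
  \<^const>\<open>ideal_prod\<close> forms finite sums of products of elements of arbitrary nonempty sets.\<close>

definition extended_ideal ::
  "('r, 'k) ring_scheme \<Rightarrow> ('g, 'm) monoid_scheme \<Rightarrow> ('g \<Rightarrow> 'r \<Rightarrow> 'r) \<Rightarrow> ('g \<Rightarrow> 'g \<Rightarrow> 'r)
    \<Rightarrow> 'r set \<Rightarrow> ('g \<Rightarrow> 'r) set"
  where "extended_ideal R G \<sigma> c I =
    ((\<lambda>r. cp_monomial R G r \<one>\<^bsub>G\<^esub>) ` I)
      \<cdot>\<^bsub>crossed_product R G \<sigma> c\<^esub> carrier (crossed_product R G \<sigma> c)"

definition right_S_prime ::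
  "('r, 'k) ring_scheme \<Rightarrow> ('g, 'm) monoid_scheme \<Rightarrow> ('g \<Rightarrow> 'r \<Rightarrow> 'r) \<Rightarrow> ('g \<Rightarrow> 'g \<Rightarrow> 'r)
    \<Rightarrow> 'r set \<Rightarrow> bool"
  where "right_S_prime R G \<sigma> c I \<longleftrightarrow>
    nc_prime_ideal (extended_ideal R G \<sigma> c I) (crossed_product R G \<sigma> c)"

end

theory Submission
  imports Defs
begin

text \<open>The ideal \<open>IS\<close> consists of the elements of \<open>S\<close> with all coefficients in \<open>I\<close>. If it is prime, (2)
  follows from \<open>(a g) S b \<subseteq> IS\<close>. Conversely, let \<open>AB \<subseteq> IS\<close> and choose \<open>f \<in> A\<close>, \<open>f' \<in> B\<close> outside \<open>IS\<close> with the
  least number of coefficients not in \<open>I\<close>. For each \<open>h\<close>, a unique product \<open>x (h y)\<close> in \<open>f r h f'\<close>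
  gives \<open>a\<^sub>x R\<^sup>x (b\<^sub>y\<^sup>h)\<^sup>x \<subseteq> I\<close> for one pair \<open>(x, y)\<close>, which depends on \<open>h\<close>. Multiplying \<open>r h f'\<close> on the left by
  \<open>a\<^sub>x x\<close> loses a coefficient, so by minimality of \<open>f'\<close> the inclusion holds for this \<open>x\<close> and all \<open>y\<close>;
  multiplying \<open>f\<close> on the right by \<open>r b\<^sub>y\<^sup>h\<close> loses the coefficient at \<open>x\<close>, so by minimality of \<open>f\<close> it
  holds for all \<open>x\<close> and \<open>y\<close>. It now holds for all \<open>h\<close> with \<open>x\<close> and \<open>y\<close> fixed, which contradicts (2).

  For (2) and (3), the elements \<open>a\<close> satisfying the hypothesis of (2) for given \<open>b\<close>, \<open>g\<close> form a left ideal
  \<open>A\<close>, and the elements \<open>b\<close> satisfying it for all \<open>a \<in> A\<close> form a \<open>G\<close>-stable ideal.\<close>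

section \<open>Ideals of noncommutative rings\<close>

text \<open>Closure under negation comes from left multiplication by
  \<open>\<ominus> \<one>\<close>.\<close>

lemma (in ring) additive_subgroup_of_left_closed:
  assumes "A \<subseteq> carrier R" "\<zero> \<in> A"
    and add: "\<And>a b. \<lbrakk>a \<in> A; b \<in> A\<rbrakk> \<Longrightarrow> a \<oplus> b \<in> A"
    and left: "\<And>a x. \<lbrakk>a \<in> A; x \<in> carrier R\<rbrakk> \<Longrightarrow> x \<otimes> a \<in> A"
  shows "additive_subgroup A R"
proof (rule additive_subgroupI)
  have "\<ominus> a \<in> A" if "a \<in> A" for a
    using left[of a "\<ominus> \<one>"] that assms(1) by (auto simp: l_minus)
  then show "subgroup A (add_monoid R)"
    using assms(1-3) by (intro add.subgroupI) (auto simp: a_inv_def)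
qed

lemma (in ring) left_idealI:
  assumes "A \<subseteq> carrier R" "\<zero> \<in> A"
    and "\<And>a b. \<lbrakk>a \<in> A; b \<in> A\<rbrakk> \<Longrightarrow> a \<oplus> b \<in> A"
    and "\<And>a x. \<lbrakk>a \<in> A; x \<in> carrier R\<rbrakk> \<Longrightarrow> x \<otimes> a \<in> A"
  shows "left_ideal A R"
  using additive_subgroup_of_left_closed[OF assms] assms(4)
  by (simp add: left_ideal_def left_ideal_axioms_def ring_axioms)

lemma (in ring) ideal_of_closed:
  assumes "A \<subseteq> carrier R" "\<zero> \<in> A"
    and "\<And>a b. \<lbrakk>a \<in> A; b \<in> A\<rbrakk> \<Longrightarrow> a \<oplus> b \<in> A"
    and "\<And>a x. \<lbrakk>a \<in> A; x \<in> carrier R\<rbrakk> \<Longrightarrow> x \<otimes> a \<in> A"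
    and "\<And>a x. \<lbrakk>a \<in> A; x \<in> carrier R\<rbrakk> \<Longrightarrow> a \<otimes> x \<in> A"
  shows "ideal A R"
  using additive_subgroup_of_left_closed[OF assms(1-4)] assms(4,5)
  by (simp add: ideal_def ideal_axioms_def ring_axioms)

text \<open>The index set is arbitrary: over an infinite set \<open>finsum\<close> is
  \<open>\<zero>\<close>, which lies in the subgroup as well.\<close>

lemma (in ring) finsum_in_additive_subgroup:
  assumes "additive_subgroup I R" "\<And>x. x \<in> A \<Longrightarrow> f x \<in> I"
  shows "finsum R f A \<in> I"
  using assms(2)
proof (induction A rule: infinite_finite_induct)
  case (insert x A)
  then have "f \<in> insert x A \<rightarrow> carrier R"
    using additive_subgroup.a_subset[OF assms(1)] by auto
  then show ?case
    using insert additive_subgroup.a_closed[OF assms(1)] by simp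
qed (use additive_subgroup.zero_closed[OF assms(1)] in simp_all)

text \<open>Multiplying by the inverse unit recovers \<open>t\<close>. This strips the twist factors
  from coefficients when only membership in the ideal matters.\<close>

lemma (in ideal) mult_unit_right_iff:
  assumes t: "t \<in> carrier R" and u: "u \<in> Units R"
  shows "t \<otimes> u \<in> I \<longleftrightarrow> t \<in> I"
proof
  assume "t \<otimes> u \<in> I"
  then have "t \<otimes> u \<otimes> inv u \<in> I" by (rule I_r_closed) (use u in simp)
  then show "t \<in> I" using t u by (simp add: m_assoc Units_closed)
qed (use u in \<open>auto intro: I_r_closed\<close>)

lemma (in ideal) add_cancel_right:
  assumes "a \<in> carrier R" "b \<in> I" "a \<oplus> b \<in> I"
  shows "a \<in> I"
proof -
  have "(a \<oplus> b) \<oplus> \<ominus> b \<in> I" using assms by (simp add: a_closed)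
  then show ?thesis using assms Icarr[OF assms(2)] by (simp add: a_assoc r_neg)
qed

lemma nc_prime_ideal_elementwise:
  fixes R (structure)
  assumes P: "nc_prime_ideal P R" and ab: "a \<in> carrier R" "b \<in> carrier R"
    and asb: "\<And>s. s \<in> carrier R \<Longrightarrow> a \<otimes> s \<otimes> b \<in> P"
  shows "a \<in> P \<or> b \<in> P"
proof -
  interpret P: ideal P R using P by (simp add: nc_prime_ideal_def)
  txt \<open>Two-sided annihilators modulo \<open>P\<close> avoid the explicit form of generated ideals.\<close>
  let ?A = "{x \<in> carrier R. \<forall>s\<in>carrier R. x \<otimes> s \<otimes> b \<in> P}"
  let ?B = "{y \<in> carrier R. \<forall>x\<in>?A. x \<otimes> y \<in> P}"
  have A_right: "x \<otimes> s \<in> ?A" if "x \<in> ?A" "s \<in> carrier R" for x s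
  proof -
    have "x \<otimes> (s \<otimes> t) \<otimes> b \<in> P" if "t \<in> carrier R" for t
      using \<open>x \<in> ?A\<close> \<open>s \<in> carrier R\<close> that by blast
    then show ?thesis using that by (simp add: P.m_assoc)
  qed
  have A: "ideal ?A R"
  proof (rule P.ideal_of_closed)
    show "\<zero> \<in> ?A" using ab by simp
    show "x \<oplus> y \<in> ?A" if "x \<in> ?A" "y \<in> ?A" for x y
      using that ab by (auto simp: P.l_distr)
    show "s \<otimes> x \<in> ?A" if "x \<in> ?A" "s \<in> carrier R" for x s
    proof -
      have "s \<otimes> (x \<otimes> t \<otimes> b) \<in> P" if "t \<in> carrier R" for t
        using \<open>x \<in> ?A\<close> \<open>s \<in> carrier R\<close> that by (intro P.I_l_closed[of "_ \<otimes> _"]) blast+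
      then show ?thesis using that ab by (simp add: P.m_assoc)
    qed
  qed (use A_right in auto)
  have B: "ideal ?B R"
  proof (rule P.ideal_of_closed)
    show "\<zero> \<in> ?B" by simp
    show "x \<oplus> y \<in> ?B" if "x \<in> ?B" "y \<in> ?B" for x y
      using that by (auto simp: P.r_distr)
    show "s \<otimes> y \<in> ?B" if "y \<in> ?B" "s \<in> carrier R" for y s
    proof -
      have "x \<otimes> (s \<otimes> y) \<in> P" if "x \<in> ?A" for x
      proof -
        \<comment> \<open>The factor \<open>s\<close> is moved over to \<open>x\<close>, because
          \<open>?A\<close> is closed under right multiplication.\<close>
        have "(x \<otimes> s) \<otimes> y \<in> P" using A_right[OF that] \<open>y \<in> ?B\<close> \<open>s \<in> carrier R\<close> by blast
        then show ?thesis using that \<open>y \<in> ?B\<close> \<open>s \<in> carrier R\<close> by (simp add: P.m_assoc)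
      qed
      then show ?thesis using that by simp
    qed
    show "y \<otimes> s \<in> ?B" if "y \<in> ?B" "s \<in> carrier R" for y s
    proof -
      have "(x \<otimes> y) \<otimes> s \<in> P" if "x \<in> ?A" for x
        using that \<open>y \<in> ?B\<close> \<open>s \<in> carrier R\<close> by (intro P.I_r_closed[of "_ \<otimes> _"]) blast+
      then show ?thesis using that by (simp add: P.m_assoc)
    qed
  qed auto
  have "z \<in> P" if "z \<in> ?A \<cdot> ?B" for z
    using that by induction auto
  then have "?A \<cdot> ?B \<subseteq> P" by (rule subsetI)
  then have "?A \<subseteq> P \<or> ?B \<subseteq> P"
    using P A B unfolding nc_prime_ideal_def by blast
  moreover have "a \<in> ?A" using ab asb by simp
  moreover have "b \<in> ?B"
  proof -
    have "x \<otimes> b \<in> P" if "x \<in> ?A" for x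
    proof -
      have "x \<otimes> \<one> \<otimes> b \<in> P" using that by blast
      then show ?thesis using that by simp
    qed
    then show ?thesis using ab by simp
  qed
  ultimately show ?thesis by blast
qed

section \<open>The crossed product as a ring\<close>

text \<open>For \<open>X = {x}\<close> and \<open>Y = {y, z}\<close> with
  \<open>y \<noteq> z\<close>, the equality would make both products coincide and leave no unique
  one.\<close>

lemma (in unique_product_monoid) left_cancel:
  assumes "x \<in> carrier G" "y \<in> carrier G" "z \<in> carrier G" "x \<otimes> y = x \<otimes> z"
  shows "y = z"
  using unique_product[of "{x}" "{y, z}"] assms by auto

context crossed_system
begin

abbreviation S :: "('g \<Rightarrow> 'r) ring"
  where "S \<equiv> crossed_product R G \<sigma> c"

abbreviation monom :: "'r \<Rightarrow> 'g \<Rightarrow> 'g \<Rightarrow> 'r"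
  where "monom \<equiv> cp_monomial R G"

text \<open>An explicit model of \<open>IS\<close> for a stable ideal \<open>I\<close>. For
  \<open>I = carrier R\<close> it is \<open>S\<close> itself, so one induction principle serves
  both.\<close>

definition coeffs_in :: "'r set \<Rightarrow> ('g \<Rightarrow> 'r) set"
  where "coeffs_in I = {f \<in> carrier S. \<forall>k\<in>carrier G. f k \<in> I}"

text \<open>The condition on the product of the indices is part of the term rather than of the index
  set, so that sums for different factors and different \<open>k\<close> can range over the same
  box.\<close>

definition coeff_term :: "('g \<Rightarrow> 'r) \<Rightarrow> ('g \<Rightarrow> 'r) \<Rightarrow> 'g \<Rightarrow> 'g \<times> 'g \<Rightarrow> 'r"
  where "coeff_term f f' k = (\<lambda>(x, y). if x \<otimes>\<^bsub>G\<^esub> y = k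
    then f x \<otimes>\<^bsub>R\<^esub> \<sigma> x (f' y) \<otimes>\<^bsub>R\<^esub> c x y else \<zero>\<^bsub>R\<^esub>)"

lemma action_closed [simp]: "\<lbrakk>g \<in> carrier G; r \<in> carrier R\<rbrakk> \<Longrightarrow> \<sigma> g r \<in> carrier R"
  using action_hom by (rule ring_hom_closed)

lemma action_add: "\<lbrakk>g \<in> carrier G; r \<in> carrier R; s \<in> carrier R\<rbrakk>
    \<Longrightarrow> \<sigma> g (r \<oplus>\<^bsub>R\<^esub> s) = \<sigma> g r \<oplus>\<^bsub>R\<^esub> \<sigma> g s"
  by (rule ring_hom_add[OF action_hom])

lemma action_times: "\<lbrakk>g \<in> carrier G; r \<in> carrier R; s \<in> carrier R\<rbrakk>
    \<Longrightarrow> \<sigma> g (r \<otimes>\<^bsub>R\<^esub> s) = \<sigma> g r \<otimes>\<^bsub>R\<^esub> \<sigma> g s"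
  by (rule ring_hom_mult[OF action_hom])

lemma action_unity [simp]: "g \<in> carrier G \<Longrightarrow> \<sigma> g \<one>\<^bsub>R\<^esub> = \<one>\<^bsub>R\<^esub>"
  by (rule ring_hom_one[OF action_hom])

lemma action_zero [simp]: "g \<in> carrier G \<Longrightarrow> \<sigma> g \<zero>\<^bsub>R\<^esub> = \<zero>\<^bsub>R\<^esub>"
  using ring_hom_zero[OF action_hom R.ring_axioms R.ring_axioms] .

lemma action_Units:
  assumes g: "g \<in> carrier G" and u: "u \<in> Units R"
  shows "\<sigma> g u \<in> Units R"
proof -
  obtain v where v: "v \<in> carrier R" "u \<otimes>\<^bsub>R\<^esub> v = \<one>\<^bsub>R\<^esub>" "v \<otimes>\<^bsub>R\<^esub> u = \<one>\<^bsub>R\<^esub>" and u': "u \<in> carrier R"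
    using u by (auto simp: Units_def)
  have "\<sigma> g u \<otimes>\<^bsub>R\<^esub> \<sigma> g v = \<one>\<^bsub>R\<^esub>" "\<sigma> g v \<otimes>\<^bsub>R\<^esub> \<sigma> g u = \<one>\<^bsub>R\<^esub>"
    using v u' g by (simp_all flip: action_times)
  then show ?thesis using v u' g by (auto simp: Units_def)
qed

lemma twist_closed [simp]: "\<lbrakk>g \<in> carrier G; h \<in> carrier G\<rbrakk> \<Longrightarrow> c g h \<in> carrier R"
  using twist_unit by auto

lemma carrier_S: "f \<in> carrier S \<longleftrightarrow> f \<in> carrier G \<rightarrow>\<^sub>E carrier R \<and> finite (coeff_support R G f)"
  by (simp add: crossed_product_def)

lemma coeff_zero [simp]: "k \<in> carrier G \<Longrightarrow> \<zero>\<^bsub>S\<^esub> k = \<zero>\<^bsub>R\<^esub>"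
  by (simp add: crossed_product_def)

lemma coeff_add [simp]: "k \<in> carrier G \<Longrightarrow> (f \<oplus>\<^bsub>S\<^esub> f') k = f k \<oplus>\<^bsub>R\<^esub> f' k"
  by (simp add: crossed_product_def)

lemma one_S: "\<one>\<^bsub>S\<^esub> = monom \<one>\<^bsub>R\<^esub> \<one>\<^bsub>G\<^esub>"
  by (simp add: crossed_product_def)

lemma coeff_mult_sum: "k \<in> carrier G \<Longrightarrow> (f \<otimes>\<^bsub>S\<^esub> f') k
    = finsum R (\<lambda>(x, y). f x \<otimes>\<^bsub>R\<^esub> \<sigma> x (f' y) \<otimes>\<^bsub>R\<^esub> c x y)
        {(x, y) \<in> coeff_support R G f \<times> coeff_support R G f'. x \<otimes>\<^bsub>G\<^esub> y = k}"
  by (simp add: crossed_product_def)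

lemma coeff_outside:
  assumes "k \<notin> carrier G"
  shows "\<zero>\<^bsub>S\<^esub> k = undefined" "(f \<oplus>\<^bsub>S\<^esub> f') k = undefined" "(f \<otimes>\<^bsub>S\<^esub> f') k = undefined"
  using assms by (simp_all add: crossed_product_def)

lemma coeff_closed [simp]: "\<lbrakk>f \<in> carrier S; k \<in> carrier G\<rbrakk> \<Longrightarrow> f k \<in> carrier R"
  by (auto simp: carrier_S)

lemma finite_supp [simp]: "f \<in> carrier S \<Longrightarrow> finite (coeff_support R G f)"
  by (simp add: carrier_S)

lemma supp_subset [simp]: "coeff_support R G f \<subseteq> carrier G"
  by (auto simp: coeff_support_def)

lemma supp_in_carrier: "g \<in> coeff_support R G f \<Longrightarrow> g \<in> carrier G"
  by (simp add: coeff_support_def)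

lemma S_eqI: "\<lbrakk>f \<in> carrier S; f' \<in> carrier S; \<And>k. k \<in> carrier G \<Longrightarrow> f k = f' k\<rbrakk> \<Longrightarrow> f = f'"
  unfolding carrier_S by (blast intro: PiE_ext)

lemma coeff_monom [simp]: "k \<in> carrier G \<Longrightarrow> monom r g k = (if k = g then r else \<zero>\<^bsub>R\<^esub>)"
  by (simp add: cp_monomial_def)

lemma supp_monom: "coeff_support R G (monom r g) \<subseteq> {g}"
  by (auto simp: coeff_support_def split: if_splits)

lemma monom_closed [simp]: "r \<in> carrier R \<Longrightarrow> monom r g \<in> carrier S"
  using finite_subset[OF supp_monom] by (auto simp: carrier_S cp_monomial_def)

lemma supp_zero [simp]: "coeff_support R G \<zero>\<^bsub>S\<^esub> = {}"
  by (simp add: coeff_support_def)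

lemma zero_closed: "\<zero>\<^bsub>S\<^esub> \<in> carrier S"
  unfolding carrier_S by (auto simp: coeff_outside)

lemma add_closed:
  assumes "f \<in> carrier S" "f' \<in> carrier S"
  shows "f \<oplus>\<^bsub>S\<^esub> f' \<in> carrier S"
proof -
  have "coeff_support R G (f \<oplus>\<^bsub>S\<^esub> f') \<subseteq> coeff_support R G f \<union> coeff_support R G f'"
    using assms by (auto simp: coeff_support_def)
  then have "finite (coeff_support R G (f \<oplus>\<^bsub>S\<^esub> f'))"
    by (rule finite_subset) (use assms in auto)
  moreover have "f \<oplus>\<^bsub>S\<^esub> f' \<in> carrier G \<rightarrow>\<^sub>E carrier R"
  proof (rule PiE_I)
    show "(f \<oplus>\<^bsub>S\<^esub> f') k \<in> carrier R" if "k \<in> carrier G" for k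
      using assms that by simp
    show "(f \<oplus>\<^bsub>S\<^esub> f') k = undefined" if "k \<notin> carrier G" for k
      using that by (simp add: coeff_outside)
  qed
  ultimately show ?thesis by (simp add: carrier_S)
qed

section \<open>Coefficients of products as sums over finite boxes\<close>

lemma coeff_term_closed [simp]:
  assumes "f \<in> carrier S" "f' \<in> carrier S" "p \<in> carrier G \<times> carrier G"
  shows "coeff_term f f' k p \<in> carrier R"
  using assms by (cases p) (simp add: coeff_term_def)

text \<open>Enlarging the supports to a box \<open>X \<times> Y\<close> adds only zero terms.
  Products of elements with different supports thus become comparable over a common index
  set.\<close>

lemma coeff_mult:
  assumes f: "f \<in> carrier S" "coeff_support R G f \<subseteq> X" "finite X" "X \<subseteq> carrier G"
    and f': "f' \<in> carrier S" "coeff_support R G f' \<subseteq> Y" "finite Y" "Y \<subseteq> carrier G"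
    and k: "k \<in> carrier G"
  shows "(f \<otimes>\<^bsub>S\<^esub> f') k = finsum R (coeff_term f f' k) (X \<times> Y)"
proof -
  let ?Z = "{(x, y) \<in> coeff_support R G f \<times> coeff_support R G f'. x \<otimes>\<^bsub>G\<^esub> y = k}"
  have "(f \<otimes>\<^bsub>S\<^esub> f') k = finsum R (\<lambda>(x, y). f x \<otimes>\<^bsub>R\<^esub> \<sigma> x (f' y) \<otimes>\<^bsub>R\<^esub> c x y) ?Z"
    using k by (rule coeff_mult_sum)
  also have "\<dots> = finsum R (coeff_term f f' k) (X \<times> Y)"
  proof (rule R.add.finprod_mono_neutral_cong_left)
    show "finite (X \<times> Y)" "?Z \<subseteq> X \<times> Y" using f f' by auto
    show "coeff_term f f' k \<in> X \<times> Y \<rightarrow> carrier R"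
      using f f' by (intro funcsetI coeff_term_closed) auto
    show "coeff_term f f' k p = \<zero>\<^bsub>R\<^esub>" if "p \<in> X \<times> Y - ?Z" for p
    proof -
      obtain x y where p: "p = (x, y)" by (cases p)
      with that have xy: "x \<in> X" "y \<in> Y" "(x, y) \<notin> ?Z" by auto
      then have "x \<in> carrier G" "y \<in> carrier G" using f f' by auto
      moreover from this xy have "f x = \<zero>\<^bsub>R\<^esub> \<or> f' y = \<zero>\<^bsub>R\<^esub> \<or> x \<otimes>\<^bsub>G\<^esub> y \<noteq> k"
        by (auto simp: coeff_support_def)
      ultimately show ?thesis using f(1) f'(1) p by (auto simp: coeff_term_def)
    qed
    show "(case p of (x, y) \<Rightarrow> f x \<otimes>\<^bsub>R\<^esub> \<sigma> x (f' y) \<otimes>\<^bsub>R\<^esub> c x y) = coeff_term f f' k p"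
      if "p \<in> ?Z" for p
      using that by (auto simp: coeff_term_def)
  qed
  finally show ?thesis .
qed

lemma mult_closed:
  assumes "f \<in> carrier S" "f' \<in> carrier S"
  shows "f \<otimes>\<^bsub>S\<^esub> f' \<in> carrier S"
proof -
  let ?X = "coeff_support R G f" and ?Y = "coeff_support R G f'"
  have cl: "finsum R (coeff_term f f' k) (?X \<times> ?Y) \<in> carrier R" for k
    using assms by (intro R.finsum_closed funcsetI coeff_term_closed) (auto simp: coeff_support_def)
  have eq: "(f \<otimes>\<^bsub>S\<^esub> f') k = finsum R (coeff_term f f' k) (?X \<times> ?Y)" if "k \<in> carrier G" for k
    using assms that by (intro coeff_mult) auto
  \<comment> \<open>An index that is not a product of two support elements has only zero terms in
    its sum.\<close>
  have "coeff_support R G (f \<otimes>\<^bsub>S\<^esub> f') \<subseteq> (\<lambda>(x, y). x \<otimes>\<^bsub>G\<^esub> y) ` (?X \<times> ?Y)"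
  proof
    fix k assume k: "k \<in> coeff_support R G (f \<otimes>\<^bsub>S\<^esub> f')"
    show "k \<in> (\<lambda>(x, y). x \<otimes>\<^bsub>G\<^esub> y) ` (?X \<times> ?Y)"
    proof (rule ccontr)
      assume "k \<notin> (\<lambda>(x, y). x \<otimes>\<^bsub>G\<^esub> y) ` (?X \<times> ?Y)"
      then have "finsum R (coeff_term f f' k) (?X \<times> ?Y) = \<zero>\<^bsub>R\<^esub>"
        by (intro R.add.finprod_one_eqI) (auto simp: coeff_term_def)
      with k eq[of k] show False by (auto simp: coeff_support_def)
    qed
  qed
  then have "finite (coeff_support R G (f \<otimes>\<^bsub>S\<^esub> f'))"
    by (rule finite_subset) (use assms in auto)
  moreover have "f \<otimes>\<^bsub>S\<^esub> f' \<in> carrier G \<rightarrow>\<^sub>E carrier R"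
  proof (rule PiE_I)
    show "(f \<otimes>\<^bsub>S\<^esub> f') k \<in> carrier R" if "k \<in> carrier G" for k
      using cl eq that by simp
    show "(f \<otimes>\<^bsub>S\<^esub> f') k = undefined" if "k \<notin> carrier G" for k
      using that by (simp add: coeff_outside)
  qed
  ultimately show ?thesis by (simp add: carrier_S)
qed

section \<open>Additive group and distributive laws\<close>

lemma abelian_group_S: "abelian_group S"
proof (rule abelian_groupI)
  fix f assume f: "f \<in> carrier S"
  let ?n = "\<lambda>k\<in>carrier G. \<ominus>\<^bsub>R\<^esub> f k"
  have "coeff_support R G ?n = coeff_support R G f"
    using f by (auto simp: coeff_support_def)
  then have "?n \<in> carrier S" using f by (auto simp: carrier_S)
  moreover have "?n \<oplus>\<^bsub>S\<^esub> f = \<zero>\<^bsub>S\<^esub>"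
    using f calculation by (intro S_eqI add_closed zero_closed) (auto simp: R.l_neg)
  ultimately show "\<exists>f'\<in>carrier S. f' \<oplus>\<^bsub>S\<^esub> f = \<zero>\<^bsub>S\<^esub>" by blast
qed (auto intro!: S_eqI add_closed zero_closed simp: R.a_ac)

lemma coeff_term_add_left:
  assumes "f \<in> carrier S" "f' \<in> carrier S" "h \<in> carrier S" "p \<in> carrier G \<times> carrier G"
  shows "coeff_term (f \<oplus>\<^bsub>S\<^esub> f') h k p = coeff_term f h k p \<oplus>\<^bsub>R\<^esub> coeff_term f' h k p"
  using assms by (cases p) (simp add: coeff_term_def R.l_distr)

lemma coeff_term_add_right:
  assumes "f \<in> carrier S" "f' \<in> carrier S" "h \<in> carrier S" "p \<in> carrier G \<times> carrier G"
  shows "coeff_term h (f \<oplus>\<^bsub>S\<^esub> f') k p = coeff_term h f k p \<oplus>\<^bsub>R\<^esub> coeff_term h f' k p"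
  using assms by (cases p) (simp add: coeff_term_def action_add R.l_distr R.r_distr)

lemma l_distr_S:
  assumes "f \<in> carrier S" "f' \<in> carrier S" "h \<in> carrier S"
  shows "(f \<oplus>\<^bsub>S\<^esub> f') \<otimes>\<^bsub>S\<^esub> h = f \<otimes>\<^bsub>S\<^esub> h \<oplus>\<^bsub>S\<^esub> f' \<otimes>\<^bsub>S\<^esub> h"
proof (rule S_eqI)
  fix k assume k: "k \<in> carrier G"
  \<comment> \<open>The union bounds the supports of \<open>f\<close>, \<open>f'\<close> and their
    sum, so all three products are summed over one box.\<close>
  let ?X = "coeff_support R G f \<union> coeff_support R G f'" and ?Y = "coeff_support R G h"
  have X: "finite ?X" "?X \<subseteq> carrier G" and Y: "?Y \<subseteq> carrier G"
    using assms by auto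
  have "coeff_support R G (f \<oplus>\<^bsub>S\<^esub> f') \<subseteq> ?X" using assms by (auto simp: coeff_support_def)
  then have "((f \<oplus>\<^bsub>S\<^esub> f') \<otimes>\<^bsub>S\<^esub> h) k = finsum R (coeff_term (f \<oplus>\<^bsub>S\<^esub> f') h k) (?X \<times> ?Y)"
    using assms X k by (intro coeff_mult add_closed) auto
  also have "\<dots> = finsum R (\<lambda>p. coeff_term f h k p \<oplus>\<^bsub>R\<^esub> coeff_term f' h k p) (?X \<times> ?Y)"
    using assms X Y
    by (intro R.add.finprod_cong' coeff_term_add_left funcsetI R.a_closed coeff_term_closed)
      (auto dest: supp_in_carrier)
  also have "\<dots> = finsum R (coeff_term f h k) (?X \<times> ?Y) \<oplus>\<^bsub>R\<^esub> finsum R (coeff_term f' h k) (?X \<times> ?Y)"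
    using assms X Y
    by (intro R.finsum_addf funcsetI coeff_term_closed)
      (auto dest: supp_in_carrier)
  also have "\<dots> = (f \<otimes>\<^bsub>S\<^esub> h \<oplus>\<^bsub>S\<^esub> f' \<otimes>\<^bsub>S\<^esub> h) k"
    using assms X k by (simp add: coeff_mult[of _ ?X _ ?Y])
  finally show "((f \<oplus>\<^bsub>S\<^esub> f') \<otimes>\<^bsub>S\<^esub> h) k = (f \<otimes>\<^bsub>S\<^esub> h \<oplus>\<^bsub>S\<^esub> f' \<otimes>\<^bsub>S\<^esub> h) k" .
qed (use assms in \<open>auto intro!: add_closed mult_closed\<close>)

lemma r_distr_S:
  assumes "f \<in> carrier S" "f' \<in> carrier S" "h \<in> carrier S"
  shows "h \<otimes>\<^bsub>S\<^esub> (f \<oplus>\<^bsub>S\<^esub> f') = h \<otimes>\<^bsub>S\<^esub> f \<oplus>\<^bsub>S\<^esub> h \<otimes>\<^bsub>S\<^esub> f'"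
proof (rule S_eqI)
  fix k assume k: "k \<in> carrier G"
  let ?X = "coeff_support R G f \<union> coeff_support R G f'" and ?Y = "coeff_support R G h"
  have X: "finite ?X" "?X \<subseteq> carrier G" and Y: "?Y \<subseteq> carrier G"
    using assms by auto
  have "coeff_support R G (f \<oplus>\<^bsub>S\<^esub> f') \<subseteq> ?X" using assms by (auto simp: coeff_support_def)
  then have "(h \<otimes>\<^bsub>S\<^esub> (f \<oplus>\<^bsub>S\<^esub> f')) k = finsum R (coeff_term h (f \<oplus>\<^bsub>S\<^esub> f') k) (?Y \<times> ?X)"
    using assms X k by (intro coeff_mult add_closed) auto
  also have "\<dots> = finsum R (\<lambda>p. coeff_term h f k p \<oplus>\<^bsub>R\<^esub> coeff_term h f' k p) (?Y \<times> ?X)"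
    using assms X Y
    by (intro R.add.finprod_cong' coeff_term_add_right funcsetI R.a_closed coeff_term_closed)
      (auto dest: supp_in_carrier)
  also have "\<dots> = finsum R (coeff_term h f k) (?Y \<times> ?X) \<oplus>\<^bsub>R\<^esub> finsum R (coeff_term h f' k) (?Y \<times> ?X)"
    using assms X Y
    by (intro R.finsum_addf funcsetI coeff_term_closed)
      (auto dest: supp_in_carrier)
  also have "\<dots> = (h \<otimes>\<^bsub>S\<^esub> f \<oplus>\<^bsub>S\<^esub> h \<otimes>\<^bsub>S\<^esub> f') k"
    using assms X k by (simp add: coeff_mult[of _ ?Y _ ?X])
  finally show "(h \<otimes>\<^bsub>S\<^esub> (f \<oplus>\<^bsub>S\<^esub> f')) k = (h \<otimes>\<^bsub>S\<^esub> f \<oplus>\<^bsub>S\<^esub> h \<otimes>\<^bsub>S\<^esub> f') k" .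
qed (use assms in \<open>auto intro!: add_closed mult_closed\<close>)

section \<open>Reduction to monomials, associativity and unit\<close>

text \<open>Induction on a finite set that bounds the support: the coefficient at one index
  \<open>g\<close> is split off as a monomial, and the remainder, still with coefficients in
  \<open>I\<close>, has support in the smaller set.\<close>

lemma coeffs_in_induct [consumes 2, case_names zero monom add]:
  assumes I: "additive_subgroup I R" and f: "f \<in> coeffs_in I"
    and zero: "P \<zero>\<^bsub>S\<^esub>"
    and monom: "\<And>r g. \<lbrakk>r \<in> I; g \<in> carrier G\<rbrakk> \<Longrightarrow> P (monom r g)"
    and add: "\<And>f f'. \<lbrakk>f \<in> carrier S; f' \<in> carrier S; P f; P f'\<rbrakk> \<Longrightarrow> P (f \<oplus>\<^bsub>S\<^esub> f')"
  shows "P f"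
proof -
  have "\<forall>f. f \<in> coeffs_in I \<and> coeff_support R G f \<subseteq> F \<longrightarrow> P f" if "finite F" for F
    using that
  proof induction
    case empty
    have "f = \<zero>\<^bsub>S\<^esub>" if "f \<in> coeffs_in I" "coeff_support R G f \<subseteq> {}" for f
      using that by (intro S_eqI zero_closed) (auto simp: coeffs_in_def coeff_support_def)
    with zero show ?case by auto
  next
    case (insert g F)
    show ?case
    proof (intro allI impI)
      fix f assume f: "f \<in> coeffs_in I \<and> coeff_support R G f \<subseteq> insert g F"
      show "P f"
      proof (cases "g \<in> carrier G")
        case False
        \<comment> \<open>Supports lie in \<open>carrier G\<close>, so the support of
          \<open>f\<close> is already inside \<open>F\<close>.\<close>
        with f insert.IH show ?thesis using supp_subset[of f] by blast
      next
        case g: True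
        let ?f = "f(g := \<zero>\<^bsub>R\<^esub>)"
        have s: "coeff_support R G ?f = coeff_support R G f - {g}"
          by (auto simp: coeff_support_def)
        have fc: "f \<in> carrier S" and fg: "f g \<in> I" using f g by (auto simp: coeffs_in_def)
        have f': "?f \<in> carrier S"
          using fc g by (auto simp: carrier_S s)
        have "?f \<in> coeffs_in I"
          using f f' additive_subgroup.zero_closed[OF I] by (auto simp: coeffs_in_def)
        moreover have "coeff_support R G ?f \<subseteq> F" using f by (auto simp: s)
        ultimately have "P ?f" using insert.IH by blast
        then have "P (monom (f g) g \<oplus>\<^bsub>S\<^esub> ?f)"
          using monom fg g fc f' by (intro add) auto
        also have "monom (f g) g \<oplus>\<^bsub>S\<^esub> ?f = f"
          using g fc f' by (intro S_eqI add_closed) auto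
        finally show ?thesis .
      qed
    qed
  qed
  moreover have "finite (coeff_support R G f)" using f by (simp add: coeffs_in_def)
  ultimately show ?thesis using f by blast
qed

lemma l_null_S: "f \<in> carrier S \<Longrightarrow> \<zero>\<^bsub>S\<^esub> \<otimes>\<^bsub>S\<^esub> f = \<zero>\<^bsub>S\<^esub>"
  by (intro S_eqI mult_closed zero_closed) (simp_all add: coeff_mult_sum)

lemma r_null_S: "f \<in> carrier S \<Longrightarrow> f \<otimes>\<^bsub>S\<^esub> \<zero>\<^bsub>S\<^esub> = \<zero>\<^bsub>S\<^esub>"
  by (intro S_eqI mult_closed zero_closed) (simp_all add: coeff_mult_sum)

lemma additive_subgroup_carrier: "additive_subgroup (carrier R) R"
  by (simp add: additive_subgroup_def R.add.subgroup_self)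

lemma coeffs_in_carrier: "coeffs_in (carrier R) = carrier S"
  by (auto simp: coeffs_in_def)

lemma S_induct [consumes 1, case_names zero monom add]:
  assumes "f \<in> carrier S"
    and "P \<zero>\<^bsub>S\<^esub>"
    and "\<And>r g. \<lbrakk>r \<in> carrier R; g \<in> carrier G\<rbrakk> \<Longrightarrow> P (monom r g)"
    and "\<And>f f'. \<lbrakk>f \<in> carrier S; f' \<in> carrier S; P f; P f'\<rbrakk> \<Longrightarrow> P (f \<oplus>\<^bsub>S\<^esub> f')"
  shows "P f"
  using additive_subgroup_carrier assms(1)[folded coeffs_in_carrier] assms(2-4)
  by (rule coeffs_in_induct)

text \<open>The axiom \<open>action_mult\<close> moves \<open>c x y\<close> to the right past the
  image of \<open>t\<close>; the two adjacent twist factors are then rewritten by the cocycle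
  identity.\<close>

lemma monom_assoc:
  assumes "r \<in> carrier R" "s \<in> carrier R" "t \<in> carrier R"
    and "x \<in> carrier G" "y \<in> carrier G" "z \<in> carrier G"
  shows "(monom r x \<otimes>\<^bsub>S\<^esub> monom s y) \<otimes>\<^bsub>S\<^esub> monom t z = monom r x \<otimes>\<^bsub>S\<^esub> (monom s y \<otimes>\<^bsub>S\<^esub> monom t z)"
proof -
  have "r \<otimes>\<^bsub>R\<^esub> \<sigma> x s \<otimes>\<^bsub>R\<^esub> c x y \<otimes>\<^bsub>R\<^esub> \<sigma> (x \<otimes>\<^bsub>G\<^esub> y) t \<otimes>\<^bsub>R\<^esub> c (x \<otimes>\<^bsub>G\<^esub> y) z
      = r \<otimes>\<^bsub>R\<^esub> \<sigma> x s \<otimes>\<^bsub>R\<^esub> (c x y \<otimes>\<^bsub>R\<^esub> \<sigma> (x \<otimes>\<^bsub>G\<^esub> y) t) \<otimes>\<^bsub>R\<^esub> c (x \<otimes>\<^bsub>G\<^esub> y) z"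
    using assms by (simp add: R.m_assoc)
  also have "\<dots> = r \<otimes>\<^bsub>R\<^esub> \<sigma> x s \<otimes>\<^bsub>R\<^esub> (\<sigma> x (\<sigma> y t) \<otimes>\<^bsub>R\<^esub> c x y) \<otimes>\<^bsub>R\<^esub> c (x \<otimes>\<^bsub>G\<^esub> y) z"
    using assms by (simp add: action_mult)
  also have "\<dots> = r \<otimes>\<^bsub>R\<^esub> \<sigma> x s \<otimes>\<^bsub>R\<^esub> \<sigma> x (\<sigma> y t) \<otimes>\<^bsub>R\<^esub> (c x y \<otimes>\<^bsub>R\<^esub> c (x \<otimes>\<^bsub>G\<^esub> y) z)"
    using assms by (simp add: R.m_assoc)
  also have "\<dots> = r \<otimes>\<^bsub>R\<^esub> \<sigma> x (s \<otimes>\<^bsub>R\<^esub> \<sigma> y t \<otimes>\<^bsub>R\<^esub> c y z) \<otimes>\<^bsub>R\<^esub> c x (y \<otimes>\<^bsub>G\<^esub> z)"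
    using assms by (simp add: twist_cocycle action_times R.m_assoc)
  finally show ?thesis
    using assms by (simp add: cp_monomial_mult G.m_assoc)
qed

text \<open>Associativity spreads from monomials one argument at a time by additivity: the third
  argument here, the second in \<open>monom_left_assoc\<close>, the first in
  \<open>assoc_S\<close>.\<close>

lemma monom_monom_assoc:
  assumes "r \<in> carrier R" "s \<in> carrier R" "x \<in> carrier G" "y \<in> carrier G" "h \<in> carrier S"
  shows "(monom r x \<otimes>\<^bsub>S\<^esub> monom s y) \<otimes>\<^bsub>S\<^esub> h = monom r x \<otimes>\<^bsub>S\<^esub> (monom s y \<otimes>\<^bsub>S\<^esub> h)"
  using assms(5)
proof (induction rule: S_induct)
  case zero
  then show ?case using assms by (simp add: r_null_S mult_closed)
next
  case (monom t z)
  then show ?case using assms by (simp add: monom_assoc)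
next
  case (add h h')
  then show ?case using assms by (simp add: r_distr_S mult_closed)
qed

lemma monom_left_assoc:
  assumes "r \<in> carrier R" "x \<in> carrier G" "g \<in> carrier S" "h \<in> carrier S"
  shows "(monom r x \<otimes>\<^bsub>S\<^esub> g) \<otimes>\<^bsub>S\<^esub> h = monom r x \<otimes>\<^bsub>S\<^esub> (g \<otimes>\<^bsub>S\<^esub> h)"
  using assms(3)
proof (induction rule: S_induct)
  case zero
  then show ?case using assms by (simp add: l_null_S r_null_S)
next
  case (monom s y)
  then show ?case using assms by (simp add: monom_monom_assoc)
next
  case (add g g')
  then show ?case using assms by (simp add: l_distr_S r_distr_S mult_closed)
qed

lemma assoc_S:
  assumes "f \<in> carrier S" "g \<in> carrier S" "h \<in> carrier S"
  shows "(f \<otimes>\<^bsub>S\<^esub> g) \<otimes>\<^bsub>S\<^esub> h = f \<otimes>\<^bsub>S\<^esub> (g \<otimes>\<^bsub>S\<^esub> h)"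
  using assms(1)
proof (induction rule: S_induct)
  case zero
  then show ?case using assms by (simp add: l_null_S mult_closed)
next
  case (monom r x)
  then show ?case using assms by (simp add: monom_left_assoc)
next
  case (add f f')
  then show ?case using assms by (simp add: l_distr_S mult_closed)
qed

lemma l_one_S: "f \<in> carrier S \<Longrightarrow> \<one>\<^bsub>S\<^esub> \<otimes>\<^bsub>S\<^esub> f = f"
proof (induction rule: S_induct)
  case zero
  then show ?case by (simp add: one_S r_null_S)
next
  case (monom r x)
  then show ?case by (simp add: one_S cp_monomial_mult action_one twist_one_left)
next
  case (add f f')
  then show ?case by (simp add: one_S r_distr_S)
qed

lemma r_one_S: "f \<in> carrier S \<Longrightarrow> f \<otimes>\<^bsub>S\<^esub> \<one>\<^bsub>S\<^esub> = f"
proof (induction rule: S_induct)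
  case zero
  then show ?case by (simp add: one_S l_null_S)
next
  case (monom r x)
  then show ?case by (simp add: one_S cp_monomial_mult twist_one_right)
next
  case (add f f')
  then show ?case by (simp add: one_S l_distr_S)
qed

lemma one_closed: "\<one>\<^bsub>S\<^esub> \<in> carrier S"
  by (simp add: one_S)

lemma monoid_S: "monoid S"
  by (rule monoidI) (fact mult_closed one_closed assoc_S l_one_S r_one_S)+

lemma ring_S: "ring S"
  by (rule ringI) (fact abelian_group_S monoid_S l_distr_S r_distr_S)+


section \<open>Coefficients of products with a monomial\<close>

text \<open>By left cancellation only the coefficient of \<open>f\<close> at \<open>y\<close> is
  sent to the index \<open>g y\<close>, so the sum has a single term.\<close>

lemma coeff_monom_mult:
  assumes cancel: "unique_product_monoid G"
    and "f \<in> carrier S" "r \<in> carrier R" "g \<in> carrier G" "y \<in> carrier G"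
  shows "(monom r g \<otimes>\<^bsub>S\<^esub> f) (g \<otimes>\<^bsub>G\<^esub> y) = r \<otimes>\<^bsub>R\<^esub> \<sigma> g (f y) \<otimes>\<^bsub>R\<^esub> c g y"
  using assms(2)
proof (induction rule: S_induct)
  case zero
  then show ?case using assms by (simp add: r_null_S)
next
  case (monom s z)
  then have "g \<otimes>\<^bsub>G\<^esub> y = g \<otimes>\<^bsub>G\<^esub> z \<longleftrightarrow> y = z"
    using unique_product_monoid.left_cancel[OF cancel] assms by blast
  then show ?case using assms monom by (simp add: cp_monomial_mult)
next
  case (add f f')
  then show ?case using assms by (simp add: r_distr_S action_add R.l_distr R.r_distr)
qed

lemma coeff_monom_mult_outside:
  assumes "f \<in> carrier S" "r \<in> carrier R" "g \<in> carrier G" "k \<in> carrier G"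
    and "\<And>y. y \<in> carrier G \<Longrightarrow> k \<noteq> g \<otimes>\<^bsub>G\<^esub> y"
  shows "(monom r g \<otimes>\<^bsub>S\<^esub> f) k = \<zero>\<^bsub>R\<^esub>"
  using assms(1)
proof (induction rule: S_induct)
  case zero
  then show ?case using assms by (simp add: r_null_S)
next
  case (monom s z)
  then show ?case using assms by (simp add: cp_monomial_mult)
next
  case (add f f')
  then show ?case using assms by (simp add: r_distr_S)
qed

text \<open>A scalar on the right fixes every index, and the twist with the identity of
  \<open>G\<close> is 1.\<close>

lemma coeff_mult_scalar:
  assumes "f \<in> carrier S" "r \<in> carrier R" "k \<in> carrier G"
  shows "(f \<otimes>\<^bsub>S\<^esub> monom r \<one>\<^bsub>G\<^esub>) k = f k \<otimes>\<^bsub>R\<^esub> \<sigma> k r"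
  using assms(1)
proof (induction rule: S_induct)
  case zero
  then show ?case using assms by (simp add: l_null_S)
next
  case (monom s z)
  then show ?case using assms by (simp add: cp_monomial_mult twist_one_right)
next
  case (add f f')
  then show ?case using assms by (simp add: l_distr_S R.l_distr)
qed

end

section \<open>Extension of a stable ideal\<close>

locale stable_ideal = crossed_system R G \<sigma> c + I: ideal I R
  for R :: "('r, 'k) ring_scheme" and G :: "('g, 'm) monoid_scheme"
  and \<sigma> :: "'g \<Rightarrow> 'r \<Rightarrow> 'r" and c :: "'g \<Rightarrow> 'g \<Rightarrow> 'r" and I :: "'r set" +
  assumes stable: "G_stable G \<sigma> I"
begin

section \<open>Products modulo a stable ideal\<close>

lemma action_in_ideal: "\<lbrakk>g \<in> carrier G; r \<in> I\<rbrakk> \<Longrightarrow> \<sigma> g r \<in> I"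
  using stable by (auto simp: G_stable_def)

text \<open>When \<open>f' y\<close> is the factor in \<open>I\<close>, stability first puts
  \<open>\<sigma> x (f' y)\<close> into \<open>I\<close>; then absorption applies on both
  sides.\<close>

lemma coeff_term_in_ideal:
  assumes "f \<in> carrier S" "f' \<in> carrier S" "x \<in> carrier G" "y \<in> carrier G"
    and "x \<otimes>\<^bsub>G\<^esub> y = k \<Longrightarrow> f x \<in> I \<or> f' y \<in> I"
  shows "coeff_term f f' k (x, y) \<in> I"
proof (cases "x \<otimes>\<^bsub>G\<^esub> y = k")
  case True
  have "f x \<otimes>\<^bsub>R\<^esub> \<sigma> x (f' y) \<in> I"
    using assms True by (auto intro: I.I_l_closed[OF action_in_ideal] I.I_r_closed[of "f x"])
  then have "f x \<otimes>\<^bsub>R\<^esub> \<sigma> x (f' y) \<otimes>\<^bsub>R\<^esub> c x y \<in> I"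
    by (rule I.I_r_closed) (simp add: assms)
  then show ?thesis by (simp add: coeff_term_def True)
qed (simp add: coeff_term_def)

lemma coeff_mult_in_ideal:
  assumes f: "f \<in> carrier S" "f' \<in> carrier S" "k \<in> carrier G"
    and I: "\<And>x y. \<lbrakk>x \<in> carrier G; y \<in> carrier G; x \<otimes>\<^bsub>G\<^esub> y = k\<rbrakk> \<Longrightarrow> f x \<in> I \<or> f' y \<in> I"
  shows "(f \<otimes>\<^bsub>S\<^esub> f') k \<in> I"
proof -
  let ?Z = "coeff_support R G f \<times> coeff_support R G f'"
  have "finsum R (coeff_term f f' k) ?Z \<in> I"
  proof (rule R.finsum_in_additive_subgroup)
    fix p assume "p \<in> ?Z"
    then obtain x y where "p = (x, y)" "x \<in> carrier G" "y \<in> carrier G"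
      by (auto dest: supp_in_carrier)
    then show "coeff_term f f' k p \<in> I" using f I coeff_term_in_ideal by blast
  qed (rule I.additive_subgroup_axioms)
  then show ?thesis
    using f coeff_mult[OF f(1) subset_refl _ _ f(2) subset_refl] by simp
qed

text \<open>Every other term of the coefficient at the product of \<open>x\<close> and
  \<open>y\<close> lies in \<open>I\<close>. Subtracting them isolates the term of
  \<open>(x, y)\<close>, whose twist factor is a unit. This is how a unique product gives
  information about the coefficients.\<close>

lemma factor_in_ideal:
  assumes f: "f \<in> carrier S" "f' \<in> carrier S" and xy: "x \<in> carrier G" "y \<in> carrier G"
    and I: "\<And>x' y'. \<lbrakk>x' \<in> carrier G; y' \<in> carrier G; x' \<otimes>\<^bsub>G\<^esub> y' = x \<otimes>\<^bsub>G\<^esub> y; (x', y') \<noteq> (x, y)\<rbrakk>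
      \<Longrightarrow> f x' \<in> I \<or> f' y' \<in> I"
    and prod: "(f \<otimes>\<^bsub>S\<^esub> f') (x \<otimes>\<^bsub>G\<^esub> y) \<in> I"
  shows "f x \<otimes>\<^bsub>R\<^esub> \<sigma> x (f' y) \<in> I"
proof -
  \<comment> \<open>Inserting \<open>x\<close> and \<open>y\<close> guarantees that the pair occurs
    in the sum even if one of its coefficients is zero.\<close>
  let ?X = "insert x (coeff_support R G f)" and ?Y = "insert y (coeff_support R G f')"
  let ?t = "coeff_term f f' (x \<otimes>\<^bsub>G\<^esub> y)"
  have fin: "finite ?X" "finite ?Y" and sub: "?X \<subseteq> carrier G" "?Y \<subseteq> carrier G"
    using f xy by auto
  have t: "?t \<in> ?X \<times> ?Y \<rightarrow> carrier R"
    using f xy by (intro funcsetI coeff_term_closed) (auto dest: supp_in_carrier)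
  have "finsum R ?t (?X \<times> ?Y - {(x, y)}) \<in> I"
  proof (rule R.finsum_in_additive_subgroup)
    fix p assume "p \<in> ?X \<times> ?Y - {(x, y)}"
    moreover obtain x' y' where p: "p = (x', y')" by (cases p)
    ultimately have "x' \<in> carrier G" "y' \<in> carrier G" "(x', y') \<noteq> (x, y)" using sub by blast+
    then show "?t p \<in> I" unfolding p using f I by (intro coeff_term_in_ideal) auto
  qed (rule I.additive_subgroup_axioms)
  moreover have "?t (x, y) \<oplus>\<^bsub>R\<^esub> finsum R ?t (?X \<times> ?Y - {(x, y)}) \<in> I"
  proof -
    have "(f \<otimes>\<^bsub>S\<^esub> f') (x \<otimes>\<^bsub>G\<^esub> y) = finsum R ?t (?X \<times> ?Y)"
      using f xy fin sub by (intro coeff_mult) auto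
    also have "?X \<times> ?Y = insert (x, y) (?X \<times> ?Y - {(x, y)})" by auto
    also have "finsum R ?t \<dots> = ?t (x, y) \<oplus>\<^bsub>R\<^esub> finsum R ?t (?X \<times> ?Y - {(x, y)})"
      using fin t f xy by (intro R.finsum_insert) auto
    finally show ?thesis using prod by simp
  qed
  ultimately have "?t (x, y) \<in> I"
    using f xy by (intro I.add_cancel_right[of "?t (x, y)"]) auto
  then have "f x \<otimes>\<^bsub>R\<^esub> \<sigma> x (f' y) \<otimes>\<^bsub>R\<^esub> c x y \<in> I" by (simp add: coeff_term_def)
  then show ?thesis using f xy twist_unit by (simp add: I.mult_unit_right_iff)
qed

section \<open>The extended ideal in terms of coefficients\<close>

lemma ideal_coeffs_in: "ideal (coeffs_in I) S"
proof (rule ring.ideal_of_closed[OF ring_S])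
  show "coeffs_in I \<subseteq> carrier S" by (auto simp: coeffs_in_def)
  show "\<zero>\<^bsub>S\<^esub> \<in> coeffs_in I" by (simp add: coeffs_in_def zero_closed)
  show "f \<oplus>\<^bsub>S\<^esub> f' \<in> coeffs_in I" if "f \<in> coeffs_in I" "f' \<in> coeffs_in I" for f f'
    using that by (simp add: coeffs_in_def add_closed)
  show "f' \<otimes>\<^bsub>S\<^esub> f \<in> coeffs_in I" "f \<otimes>\<^bsub>S\<^esub> f' \<in> coeffs_in I"
    if "f \<in> coeffs_in I" "f' \<in> carrier S" for f f'
    using that by (simp_all add: coeffs_in_def mult_closed coeff_mult_in_ideal)
qed

lemma monom_in_coeffs_in: "r \<in> I \<Longrightarrow> monom r g \<in> coeffs_in I"
  by (simp add: coeffs_in_def)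

lemma monom_in_coeffs_inD: "\<lbrakk>monom r g \<in> coeffs_in I; g \<in> carrier G\<rbrakk> \<Longrightarrow> r \<in> I"
  unfolding coeffs_in_def using coeff_monom[of g r g] by force

text \<open>One inclusion holds because \<open>coeffs_in I\<close> is an ideal containing the
  scalars from \<open>I\<close>; the other because a monomial with coefficient \<open>r\<close> is
  the scalar \<open>r\<close> times a basis element.\<close>

lemma extended_ideal_eq: "extended_ideal R G \<sigma> c I = coeffs_in I"
proof
  show "extended_ideal R G \<sigma> c I \<subseteq> coeffs_in I"
  proof
    fix f assume "f \<in> extended_ideal R G \<sigma> c I"
    then show "f \<in> coeffs_in I"
      unfolding extended_ideal_def
    proof induction
      case (prod f f')
      then show ?case by (auto intro: ideal.I_r_closed[OF ideal_coeffs_in] monom_in_coeffs_in)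
    next
      case (sum f f')
      then show ?case by (intro additive_subgroup.a_closed[OF ideal.axioms(1)[OF ideal_coeffs_in]])
    qed
  qed
  show "coeffs_in I \<subseteq> extended_ideal R G \<sigma> c I"
  proof
    fix f assume "f \<in> coeffs_in I"
    with I.additive_subgroup_axioms show "f \<in> extended_ideal R G \<sigma> c I"
    proof (induction rule: coeffs_in_induct)
      case zero
      \<comment> \<open>\<open>ideal_prod\<close> is generated by products and binary sums, so zero
        is exhibited as a product.\<close>
      have "monom \<zero>\<^bsub>R\<^esub> \<one>\<^bsub>G\<^esub> \<otimes>\<^bsub>S\<^esub> \<zero>\<^bsub>S\<^esub> \<in> extended_ideal R G \<sigma> c I"
        unfolding extended_ideal_def by (intro ideal_prod.prod imageI I.zero_closed zero_closed)
      then show ?case by (simp add: r_null_S)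
    next
      case (monom r g)
      then have "monom r \<one>\<^bsub>G\<^esub> \<otimes>\<^bsub>S\<^esub> monom \<one>\<^bsub>R\<^esub> g \<in> extended_ideal R G \<sigma> c I"
        unfolding extended_ideal_def by (intro ideal_prod.prod imageI) auto
      then show ?case using monom by (simp add: cp_monomial_mult action_one twist_one_left)
    next
      case (add f f')
      then show ?case unfolding extended_ideal_def by (intro ideal_prod.sum)
    qed
  qed
qed

section \<open>Primeness of the extended ideal implies (2)\<close>

text \<open>The image of \<open>c h y\<close> under \<open>\<sigma> x\<close> is a unit standing on
  the right. The lemma translates between coefficients of products in \<open>S\<close>, which carry
  the twist, and the hypothesis of (2), which does not.\<close>

lemma twisted_coeff_in_ideal_iff:
  assumes "a \<in> carrier R" "r \<in> carrier R" "b \<in> carrier R"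
    and "x \<in> carrier G" "h \<in> carrier G" "y \<in> carrier G"
  shows "a \<otimes>\<^bsub>R\<^esub> \<sigma> x (r \<otimes>\<^bsub>R\<^esub> \<sigma> h b \<otimes>\<^bsub>R\<^esub> c h y) \<in> I
    \<longleftrightarrow> a \<otimes>\<^bsub>R\<^esub> \<sigma> x r \<otimes>\<^bsub>R\<^esub> \<sigma> x (\<sigma> h b) \<in> I"
proof -
  have "a \<otimes>\<^bsub>R\<^esub> \<sigma> x (r \<otimes>\<^bsub>R\<^esub> \<sigma> h b \<otimes>\<^bsub>R\<^esub> c h y)
      = (a \<otimes>\<^bsub>R\<^esub> \<sigma> x r \<otimes>\<^bsub>R\<^esub> \<sigma> x (\<sigma> h b)) \<otimes>\<^bsub>R\<^esub> \<sigma> x (c h y)"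
    using assms by (simp add: action_times R.m_assoc)
  then show ?thesis
    using assms by (simp add: I.mult_unit_right_iff action_Units twist_unit)
qed

text \<open>Condition (2) of the theorem, with the inclusion in its hypothesis read
  elementwise.\<close>

definition skew_prime :: bool
  where "skew_prime \<longleftrightarrow> (\<forall>a\<in>carrier R. \<forall>b\<in>carrier R. \<forall>g\<in>carrier G.
    (\<forall>h\<in>carrier G. \<forall>r\<in>carrier R. a \<otimes>\<^bsub>R\<^esub> \<sigma> g r \<otimes>\<^bsub>R\<^esub> \<sigma> g (\<sigma> h b) \<in> I)
      \<longrightarrow> a \<in> I \<or> (\<forall>h\<in>carrier G. \<sigma> h b \<in> I))"

text \<open>The product of \<open>a g\<close>, \<open>s\<close> and \<open>b\<close> needs checking
  only for monomials \<open>s\<close>, where it is a monomial whose coefficient lies in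
  \<open>I\<close> by hypothesis. The elementwise test then gives \<open>a \<in> I\<close> or
  \<open>b \<in> I\<close>, and stability carries the latter to all images of
  \<open>b\<close>.\<close>

lemma nc_prime_imp_skew_prime:
  assumes P: "nc_prime_ideal (coeffs_in I) S"
  shows skew_prime
  unfolding skew_prime_def
proof (intro ballI impI)
  fix a b g
  assume a: "a \<in> carrier R" and b: "b \<in> carrier R" and g: "g \<in> carrier G"
    and I: "\<forall>h\<in>carrier G. \<forall>r\<in>carrier R. a \<otimes>\<^bsub>R\<^esub> \<sigma> g r \<otimes>\<^bsub>R\<^esub> \<sigma> g (\<sigma> h b) \<in> I"
  interpret J: ideal "coeffs_in I" S by (rule ideal_coeffs_in)
  have "monom a g \<otimes>\<^bsub>S\<^esub> s \<otimes>\<^bsub>S\<^esub> monom b \<one>\<^bsub>G\<^esub> \<in> coeffs_in I" if "s \<in> carrier S" for s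
    using that
  proof (induction rule: S_induct)
    case zero
    then show ?case using a b by (simp add: r_null_S l_null_S)
  next
    case (monom r h)
    \<comment> \<open>The twist of \<open>h\<close> with the identity equals 1; it is written out to
      fit \<open>twisted_coeff_in_ideal_iff\<close> and removed two steps later.\<close>
    then have "a \<otimes>\<^bsub>R\<^esub> \<sigma> g (r \<otimes>\<^bsub>R\<^esub> \<sigma> h b \<otimes>\<^bsub>R\<^esub> c h \<one>\<^bsub>G\<^esub>) \<in> I"
      using I a b g by (subst twisted_coeff_in_ideal_iff) auto
    then have "a \<otimes>\<^bsub>R\<^esub> \<sigma> g (r \<otimes>\<^bsub>R\<^esub> \<sigma> h b \<otimes>\<^bsub>R\<^esub> c h \<one>\<^bsub>G\<^esub>) \<otimes>\<^bsub>R\<^esub> c g h \<in> I"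
      by (rule I.I_r_closed) (simp add: monom g)
    then have "a \<otimes>\<^bsub>R\<^esub> \<sigma> g (r \<otimes>\<^bsub>R\<^esub> \<sigma> h b) \<otimes>\<^bsub>R\<^esub> c g h \<in> I"
      using monom b by (simp add: twist_one_right)
    moreover have "monom a g \<otimes>\<^bsub>S\<^esub> monom r h \<otimes>\<^bsub>S\<^esub> monom b \<one>\<^bsub>G\<^esub>
        = monom a g \<otimes>\<^bsub>S\<^esub> (monom r h \<otimes>\<^bsub>S\<^esub> monom b \<one>\<^bsub>G\<^esub>)"
      using monom a b g by (intro monom_assoc) auto
    moreover have "\<dots> = monom (a \<otimes>\<^bsub>R\<^esub> \<sigma> g (r \<otimes>\<^bsub>R\<^esub> \<sigma> h b) \<otimes>\<^bsub>R\<^esub> c g h) (g \<otimes>\<^bsub>G\<^esub> h)"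
      using monom a b g by (simp add: cp_monomial_mult twist_one_right)
    ultimately show ?case by (simp add: monom_in_coeffs_in)
  next
    case (add s s')
    then show ?case using a b by (simp add: r_distr_S l_distr_S mult_closed J.a_closed)
  qed
  then have "monom a g \<in> coeffs_in I \<or> monom b \<one>\<^bsub>G\<^esub> \<in> coeffs_in I"
    using a b by (intro nc_prime_ideal_elementwise[OF P]) auto
  then have "a \<in> I \<or> b \<in> I" using g monom_in_coeffs_inD by blast
  then show "a \<in> I \<or> (\<forall>h\<in>carrier G. \<sigma> h b \<in> I)" using action_in_ideal by blast
qed

section \<open>Supports modulo \<open>I\<close>, and (2) implies primeness\<close>

text \<open>The support of the image of \<open>f\<close> modulo \<open>I\<close>. Its cardinality is
  the quantity minimised in the proof of primeness.\<close>

definition supp_mod :: "('g \<Rightarrow> 'r) \<Rightarrow> 'g set"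
  where "supp_mod f = {k \<in> carrier G. f k \<notin> I}"

lemma finite_supp_mod: "f \<in> carrier S \<Longrightarrow> finite (supp_mod f)"
  by (rule finite_subset[OF _ finite_supp]) (auto simp: supp_mod_def coeff_support_def)

lemma coeffs_in_iff_supp_mod: "f \<in> coeffs_in I \<longleftrightarrow> f \<in> carrier S \<and> supp_mod f = {}"
  by (auto simp: coeffs_in_def supp_mod_def)

text \<open>Indices that are not left multiples of \<open>g\<close> have coefficient zero, and at a
  left multiple the twist is a unit, which does not affect membership in \<open>I\<close>.\<close>

lemma supp_mod_monom_mult:
  assumes G: "unique_product_monoid G" and f: "f \<in> carrier S" and r: "r \<in> carrier R" and g: "g \<in> carrier G"
  shows "supp_mod (monom r g \<otimes>\<^bsub>S\<^esub> f)
    \<subseteq> (\<lambda>y. g \<otimes>\<^bsub>G\<^esub> y) ` {y \<in> carrier G. r \<otimes>\<^bsub>R\<^esub> \<sigma> g (f y) \<notin> I}"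
proof
  fix k assume k: "k \<in> supp_mod (monom r g \<otimes>\<^bsub>S\<^esub> f)"
  then have kG: "k \<in> carrier G" and kI: "(monom r g \<otimes>\<^bsub>S\<^esub> f) k \<notin> I" by (auto simp: supp_mod_def)
  then obtain y where y: "y \<in> carrier G" "k = g \<otimes>\<^bsub>G\<^esub> y"
    using coeff_monom_mult_outside[OF f r g kG] by force
  then have "r \<otimes>\<^bsub>R\<^esub> \<sigma> g (f y) \<notin> I"
    using kI f r g by (auto simp: coeff_monom_mult[OF G] I.mult_unit_right_iff twist_unit)
  then show "k \<in> (\<lambda>y. g \<otimes>\<^bsub>G\<^esub> y) ` {y \<in> carrier G. r \<otimes>\<^bsub>R\<^esub> \<sigma> g (f y) \<notin> I}" using y by blast
qed

lemma minimal_supp_mod: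
  assumes "\<not> A \<subseteq> coeffs_in I"
  obtains f where "f \<in> A" "f \<notin> coeffs_in I"
    "\<And>f'. \<lbrakk>f' \<in> A; card (supp_mod f') < card (supp_mod f)\<rbrakk> \<Longrightarrow> f' \<in> coeffs_in I"
proof -
  obtain f\<^sub>0 where "f\<^sub>0 \<in> A \<and> f\<^sub>0 \<notin> coeffs_in I" using assms by blast
  from ex_has_least_nat[of "\<lambda>f. f \<in> A \<and> f \<notin> coeffs_in I", OF this, of "\<lambda>f. card (supp_mod f)"]
  show thesis using that by (meson not_less)
qed

lemma skew_prime_imp_nc_prime:
  assumes G: "unique_product_monoid G" and proper: "I \<noteq> carrier R" and skew_prime
  shows "nc_prime_ideal (coeffs_in I) S"
  unfolding nc_prime_ideal_def
proof (intro conjI allI impI)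
  interpret U: unique_product_monoid G by (rule G)
  show "ideal (coeffs_in I) S" by (rule ideal_coeffs_in)
  show "coeffs_in I \<noteq> carrier S"
  proof
    assume "coeffs_in I = carrier S"
    then have "monom \<one>\<^bsub>R\<^esub> \<one>\<^bsub>G\<^esub> \<in> coeffs_in I" by simp
    then have "\<one>\<^bsub>R\<^esub> \<in> I" using monom_in_coeffs_inD by blast
    then show False using I.one_imp_carrier proper by blast
  qed
  fix A B assume AB: "ideal A S \<and> ideal B S \<and> A \<cdot>\<^bsub>S\<^esub> B \<subseteq> coeffs_in I"
  interpret A: ideal A S using AB by blast
  interpret B: ideal B S using AB by blast
  show "A \<subseteq> coeffs_in I \<or> B \<subseteq> coeffs_in I"
  proof (rule ccontr)
    assume neg: "\<not> (A \<subseteq> coeffs_in I \<or> B \<subseteq> coeffs_in I)"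
    obtain f where f: "f \<in> A" "f \<notin> coeffs_in I"
      and minf: "\<And>f'. \<lbrakk>f' \<in> A; card (supp_mod f') < card (supp_mod f)\<rbrakk> \<Longrightarrow> f' \<in> coeffs_in I"
      using neg minimal_supp_mod by blast
    obtain f' where f': "f' \<in> B" "f' \<notin> coeffs_in I"
      and minf': "\<And>f. \<lbrakk>f \<in> B; card (supp_mod f) < card (supp_mod f')\<rbrakk> \<Longrightarrow> f \<in> coeffs_in I"
      using neg minimal_supp_mod by blast
    have fS: "f \<in> carrier S" "f' \<in> carrier S" using f f' A.Icarr B.Icarr by blast+
    have D: "supp_mod f \<subseteq> carrier G" "supp_mod f' \<subseteq> carrier G" by (auto simp: supp_mod_def)
    have fin: "finite (supp_mod f)" "finite (supp_mod f')" using fS finite_supp_mod by blast+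
    have ne: "supp_mod f \<noteq> {}" "supp_mod f' \<noteq> {}"
      using f f' fS by (auto simp: coeffs_in_iff_supp_mod)
    \<comment> \<open>The unique product below depends on \<open>h\<close>. The claim for every
      \<open>x'\<close> and \<open>y'\<close> allows a pair to be fixed before \<open>h\<close>
      varies, as (2) demands.\<close>
    have all: "f x' \<otimes>\<^bsub>R\<^esub> \<sigma> x' r' \<otimes>\<^bsub>R\<^esub> \<sigma> x' (\<sigma> h (f' y')) \<in> I"
      if h: "h \<in> carrier G" and x': "x' \<in> carrier G" and y': "y' \<in> carrier G" and r': "r' \<in> carrier R"
      for h x' y' r'
    proof -
      let ?Y = "(\<lambda>y. h \<otimes>\<^bsub>G\<^esub> y) ` supp_mod f'"
      have "\<exists>x\<in>supp_mod f. \<exists>k\<in>?Y. \<forall>x'\<in>supp_mod f. \<forall>k'\<in>?Y.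
          (x', k') \<noteq> (x, k) \<longrightarrow> x \<otimes>\<^bsub>G\<^esub> k \<noteq> x' \<otimes>\<^bsub>G\<^esub> k'"
        using h D fin ne by (intro U.unique_product) auto
      then obtain x y where x: "x \<in> supp_mod f" and y: "y \<in> supp_mod f'"
        and uniq: "\<And>x' k'. \<lbrakk>x' \<in> supp_mod f; k' \<in> ?Y; (x', k') \<noteq> (x, h \<otimes>\<^bsub>G\<^esub> y)\<rbrakk>
          \<Longrightarrow> x \<otimes>\<^bsub>G\<^esub> (h \<otimes>\<^bsub>G\<^esub> y) \<noteq> x' \<otimes>\<^bsub>G\<^esub> k'"
        by blast
      have xG: "x \<in> carrier G" and yG: "y \<in> carrier G" using x y D by auto
      have fx: "f x \<in> carrier R" using fS xG by simp
      let ?m = "\<lambda>r. monom r h \<otimes>\<^bsub>S\<^esub> f'"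
      have mB: "?m r \<in> B" if "r \<in> carrier R" for r
        using that f' by (intro B.I_l_closed) auto
      have mS: "?m r \<in> carrier S" if "r \<in> carrier R" for r
        using that mB B.Icarr by blast
      have mY: "supp_mod (?m r) \<subseteq> ?Y" if "r \<in> carrier R" for r
      proof -
        \<comment> \<open>By stability, a coefficient of \<open>f'\<close> inside \<open>I\<close>
          stays inside \<open>I\<close> after applying \<open>\<sigma> h\<close>.\<close>
        have "{y \<in> carrier G. r \<otimes>\<^bsub>R\<^esub> \<sigma> h (f' y) \<notin> I} \<subseteq> supp_mod f'"
          using that h by (auto simp: supp_mod_def action_in_ideal I.I_l_closed)
        then show ?thesis using supp_mod_monom_mult[OF G fS(2) that h] by blast
      qed
      have coeff_m: "?m r (h \<otimes>\<^bsub>G\<^esub> z) = r \<otimes>\<^bsub>R\<^esub> \<sigma> h (f' z) \<otimes>\<^bsub>R\<^esub> c h z"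
        if "r \<in> carrier R" "z \<in> carrier G" for r z
        using that h fS by (simp add: coeff_monom_mult[OF G])
      have iff: "a \<otimes>\<^bsub>R\<^esub> \<sigma> g (?m r (h \<otimes>\<^bsub>G\<^esub> z)) \<in> I \<longleftrightarrow> a \<otimes>\<^bsub>R\<^esub> \<sigma> g r \<otimes>\<^bsub>R\<^esub> \<sigma> g (\<sigma> h (f' z)) \<in> I"
        if "a \<in> carrier R" "r \<in> carrier R" "z \<in> carrier G" "g \<in> carrier G" for a g r z
        using that h fS by (simp add: coeff_m twisted_coeff_in_ideal_iff)
      have at_xy: "f x \<otimes>\<^bsub>R\<^esub> \<sigma> x (?m r (h \<otimes>\<^bsub>G\<^esub> y)) \<in> I" if r: "r \<in> carrier R" for r
      proof (rule factor_in_ideal)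
        have "f \<otimes>\<^bsub>S\<^esub> ?m r \<in> coeffs_in I" using AB f mB[OF r] by (auto intro: ideal_prod.prod)
        then show "(f \<otimes>\<^bsub>S\<^esub> ?m r) (x \<otimes>\<^bsub>G\<^esub> (h \<otimes>\<^bsub>G\<^esub> y)) \<in> I"
          using xG yG h by (simp add: coeffs_in_def)
        \<comment> \<open>A competing pair with both coefficients outside \<open>I\<close> would lie
          in \<open>supp_mod f \<times> ?Y\<close> and violate uniqueness.\<close>
        show "f x' \<in> I \<or> ?m r k' \<in> I"
          if "x' \<in> carrier G" "k' \<in> carrier G" "x' \<otimes>\<^bsub>G\<^esub> k' = x \<otimes>\<^bsub>G\<^esub> (h \<otimes>\<^bsub>G\<^esub> y)"
            "(x', k') \<noteq> (x, h \<otimes>\<^bsub>G\<^esub> y)" for x' k'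
          using that uniq[of x' k'] mY[OF r] by (auto simp: supp_mod_def)
      qed (use fS mS r xG yG h in auto)
      have at_x: "f x \<otimes>\<^bsub>R\<^esub> \<sigma> x r \<otimes>\<^bsub>R\<^esub> \<sigma> x (\<sigma> h (f' z)) \<in> I"
        if r: "r \<in> carrier R" and z: "z \<in> carrier G" for r z
      proof -
        let ?n = "monom (f x) x \<otimes>\<^bsub>S\<^esub> ?m r"
        let ?K = "{k \<in> carrier G. f x \<otimes>\<^bsub>R\<^esub> \<sigma> x (?m r k) \<notin> I}"
        \<comment> \<open>The index coming from \<open>y\<close> drops out by \<open>at_xy\<close>.
          Hence \<open>?n\<close>, an element of \<open>B\<close>, has fewer coefficients outside
          \<open>I\<close> than \<open>f'\<close>.\<close>
        have "?K \<subseteq> (\<lambda>z. h \<otimes>\<^bsub>G\<^esub> z) ` (supp_mod f' - {y})"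
        proof
          fix k assume k: "k \<in> ?K"
          then have "k \<in> supp_mod (?m r)"
            using fx xG by (auto simp: supp_mod_def action_in_ideal I.I_l_closed)
          then obtain z where "z \<in> supp_mod f'" "k = h \<otimes>\<^bsub>G\<^esub> z" using mY[OF r] by blast
          then show "k \<in> (\<lambda>z. h \<otimes>\<^bsub>G\<^esub> z) ` (supp_mod f' - {y})" using k at_xy[OF r] by auto
        qed
        then have "supp_mod ?n \<subseteq> (\<lambda>k. x \<otimes>\<^bsub>G\<^esub> k) ` (\<lambda>z. h \<otimes>\<^bsub>G\<^esub> z) ` (supp_mod f' - {y})"
          by (rule subset_trans[OF supp_mod_monom_mult[OF G mS[OF r] fx xG] image_mono])
        then have "card (supp_mod ?n) \<le> card (supp_mod f' - {y})"
          using fin by (intro surj_card_le[where f = "\<lambda>z. x \<otimes>\<^bsub>G\<^esub> (h \<otimes>\<^bsub>G\<^esub> z)"]) auto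
        also have "\<dots> < card (supp_mod f')" using fin(2) y by (rule card_Diff1_less)
        finally have "?n \<in> coeffs_in I"
          by (intro minf' B.I_l_closed mB r monom_closed fx)
        then have "?n (x \<otimes>\<^bsub>G\<^esub> (h \<otimes>\<^bsub>G\<^esub> z)) \<in> I" using xG h z by (simp add: coeffs_in_def)
        then have "f x \<otimes>\<^bsub>R\<^esub> \<sigma> x (?m r (h \<otimes>\<^bsub>G\<^esub> z)) \<in> I"
          using mS[OF r] fx xG h z by (simp add: coeff_monom_mult[OF G] I.mult_unit_right_iff twist_unit)
        then show ?thesis using fx r z xG by (simp add: iff)
      qed
      let ?t = "r' \<otimes>\<^bsub>R\<^esub> \<sigma> h (f' y')"
      let ?n = "f \<otimes>\<^bsub>S\<^esub> monom ?t \<one>\<^bsub>G\<^esub>"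
      have t: "?t \<in> carrier R" using r' h y' fS by simp
      have coeff_n: "?n k = f k \<otimes>\<^bsub>R\<^esub> \<sigma> k r' \<otimes>\<^bsub>R\<^esub> \<sigma> k (\<sigma> h (f' y'))" if "k \<in> carrier G" for k
        using that t fS r' h y' by (simp add: coeff_mult_scalar action_times R.m_assoc)
      \<comment> \<open>Each coefficient of \<open>?n\<close> is a right multiple of the one of
        \<open>f\<close> at the same index, and at \<open>x\<close> it lies in \<open>I\<close> by
        \<open>at_x\<close>.\<close>
      have "supp_mod ?n \<subseteq> supp_mod f - {x}"
        using at_x[OF r' y'] h y' r' fS
        by (auto simp: supp_mod_def coeff_n I.I_r_closed)
      then have "card (supp_mod ?n) < card (supp_mod f)"
        using fin x by (intro psubset_card_mono) auto
      then have "?n \<in> coeffs_in I" by (intro minf A.I_r_closed f monom_closed t)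
      then have "?n x' \<in> I" using x' by (simp add: coeffs_in_def)
      then show ?thesis using x' by (simp add: coeff_n)
    qed
    obtain x y where x: "x \<in> supp_mod f" and y: "y \<in> supp_mod f'" using ne by blast
    then have "f x \<in> I \<or> (\<forall>h\<in>carrier G. \<sigma> h (f' y) \<in> I)"
      using \<open>skew_prime\<close>[unfolded skew_prime_def, rule_format, of "f x" "f' y" x] D fS all y
      by (simp add: subset_iff)
    \<comment> \<open>Taking \<open>h\<close> to be the identity, which acts trivially, recovers
      \<open>f' y\<close>.\<close>
    then have "f x \<in> I \<or> f' y \<in> I"
      using y D fS action_one[of "f' y"] G.one_closed by (metis coeff_closed subsetD)
    then show False using x y by (simp add: supp_mod_def)
  qed
qed

section \<open>Equivalence of (2) and (3) through annihilators\<close>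

text \<open>For \<open>a\<close> in \<open>A\<close> and \<open>b\<close> in \<open>B\<close>,
  stability and absorption keep \<open>r\<close> times the image of \<open>b\<close> under
  \<open>\<sigma> h\<close> inside \<open>B\<close>. Applying \<open>\<sigma> g\<close> and
  multiplying by \<open>a\<close> therefore lands in \<open>I\<close>, which is the hypothesis of
  (2).\<close>

lemma skew_prime_imp_ideal_prime:
  assumes skew_prime and A: "left_ideal A R" and B: "ideal B R" "G_stable G \<sigma> B"
    and g: "g \<in> carrier G" and AB: "A \<cdot>\<^bsub>R\<^esub> (\<sigma> g ` B) \<subseteq> I"
  shows "A \<subseteq> I \<or> B \<subseteq> I"
proof (rule ccontr)
  interpret A: left_ideal A R by (rule A)
  interpret B: ideal B R by (rule B)
  assume "\<not> (A \<subseteq> I \<or> B \<subseteq> I)"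
  then obtain a b where a: "a \<in> A" "a \<notin> I" and b: "b \<in> B" "b \<notin> I" by blast
  have aR: "a \<in> carrier R" and bR: "b \<in> carrier R"
    using a b A.a_subset B.a_subset by blast+
  have "a \<otimes>\<^bsub>R\<^esub> \<sigma> g r \<otimes>\<^bsub>R\<^esub> \<sigma> g (\<sigma> h b) \<in> I" if h: "h \<in> carrier G" and r: "r \<in> carrier R" for h r
  proof -
    have "\<sigma> h b \<in> B" using B(2) b h by (auto simp: G_stable_def)
    then have "r \<otimes>\<^bsub>R\<^esub> \<sigma> h b \<in> B" using r by (rule B.I_l_closed)
    then have "a \<otimes>\<^bsub>R\<^esub> \<sigma> g (r \<otimes>\<^bsub>R\<^esub> \<sigma> h b) \<in> A \<cdot>\<^bsub>R\<^esub> (\<sigma> g ` B)"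
      by (intro ideal_prod.prod a imageI)
    then have "a \<otimes>\<^bsub>R\<^esub> \<sigma> g (r \<otimes>\<^bsub>R\<^esub> \<sigma> h b) \<in> I" using AB by (rule subsetD[rotated])
    then show ?thesis using aR bR g h r by (simp add: action_times R.m_assoc)
  qed
  then have "a \<in> I \<or> (\<forall>h\<in>carrier G. \<sigma> h b \<in> I)"
    using \<open>skew_prime\<close> aR bR g unfolding skew_prime_def by blast
  then have "\<sigma> \<one>\<^bsub>G\<^esub> b \<in> I" using a G.one_closed by blast
  then show False using b bR by (simp add: action_one)
qed

definition left_ann :: "'g \<Rightarrow> 'r \<Rightarrow> 'r set"
  where "left_ann g b = {x \<in> carrier R.
    \<forall>h\<in>carrier G. \<forall>r\<in>carrier R. x \<otimes>\<^bsub>R\<^esub> \<sigma> g r \<otimes>\<^bsub>R\<^esub> \<sigma> g (\<sigma> h b) \<in> I}"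

text \<open>Chosen so that \<open>b\<close> belongs to \<open>right_ann g (left_ann g b)\<close>:
  every \<open>a\<close>, \<open>b\<close> as in (2) lie in a pair of sets to which (3)
  applies.\<close>

definition right_ann :: "'g \<Rightarrow> 'r set \<Rightarrow> 'r set"
  where "right_ann g A = {y \<in> carrier R. \<forall>x\<in>A. x \<in> left_ann g y}"

lemma left_annD:
  "\<lbrakk>x \<in> left_ann g b; h \<in> carrier G; r \<in> carrier R\<rbrakk> \<Longrightarrow> x \<otimes>\<^bsub>R\<^esub> \<sigma> g r \<otimes>\<^bsub>R\<^esub> \<sigma> g (\<sigma> h b) \<in> I"
  by (simp add: left_ann_def)

lemma left_ann_subset: "left_ann g b \<subseteq> carrier R"
  by (auto simp: left_ann_def)

lemma left_ideal_left_ann: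
  assumes b: "b \<in> carrier R" and g: "g \<in> carrier G"
  shows "left_ideal (left_ann g b) R"
proof (rule R.left_idealI)
  show "left_ann g b \<subseteq> carrier R" by (rule left_ann_subset)
  show "\<zero>\<^bsub>R\<^esub> \<in> left_ann g b" using b g by (simp add: left_ann_def)
  show "x \<oplus>\<^bsub>R\<^esub> y \<in> left_ann g b" if "x \<in> left_ann g b" "y \<in> left_ann g b" for x y
    using that b g by (simp add: left_ann_def R.l_distr)
  show "s \<otimes>\<^bsub>R\<^esub> x \<in> left_ann g b" if x: "x \<in> left_ann g b" and s: "s \<in> carrier R" for x s
  proof -
    have xR: "x \<in> carrier R" using x left_ann_subset by blast
    have "s \<otimes>\<^bsub>R\<^esub> x \<otimes>\<^bsub>R\<^esub> \<sigma> g r \<otimes>\<^bsub>R\<^esub> \<sigma> g (\<sigma> h b) \<in> I"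
      if h: "h \<in> carrier G" and r: "r \<in> carrier R" for h r
    proof -
      have "s \<otimes>\<^bsub>R\<^esub> (x \<otimes>\<^bsub>R\<^esub> \<sigma> g r \<otimes>\<^bsub>R\<^esub> \<sigma> g (\<sigma> h b)) \<in> I"
        using left_annD[OF x h r] s by (rule I.I_l_closed)
      then show ?thesis using xR s b g h r by (simp add: R.m_assoc)
    qed
    then show ?thesis using xR s by (simp add: left_ann_def)
  qed
qed

text \<open>In the surjective case \<open>s\<close> times a value of \<open>\<sigma> g\<close> is
  again a value of \<open>\<sigma> g\<close>, so right multiplication by \<open>s\<close> only
  changes the element \<open>r\<close>. In the commutative case right closure is left
  closure.\<close>

lemma ideal_left_ann:
  assumes comm: "cring R \<or> pointwise_surjective R G \<sigma>" and b: "b \<in> carrier R" and g: "g \<in> carrier G"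
  shows "ideal (left_ann g b) R"
proof -
  interpret L: left_ideal "left_ann g b" R by (rule left_ideal_left_ann[OF b g])
  have "x \<otimes>\<^bsub>R\<^esub> s \<in> left_ann g b" if x: "x \<in> left_ann g b" and s: "s \<in> carrier R" for x s
    using comm
  proof
    assume "cring R"
    then interpret C: cring R .
    have "x \<in> carrier R" using x left_ann_subset by blast
    then show ?thesis using L.left_closed[OF x s] s by (simp add: C.m_comm)
  next
    assume surj: "pointwise_surjective R G \<sigma>"
    have xR: "x \<in> carrier R" using x left_ann_subset by blast
    have "x \<otimes>\<^bsub>R\<^esub> s \<otimes>\<^bsub>R\<^esub> \<sigma> g r \<otimes>\<^bsub>R\<^esub> \<sigma> g (\<sigma> h b) \<in> I"
      if h: "h \<in> carrier G" and r: "r \<in> carrier R" for h r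
    proof -
      have "s \<otimes>\<^bsub>R\<^esub> \<sigma> g r \<in> \<sigma> g ` carrier R"
        using surj g s r unfolding pointwise_surjective_def by simp
      then obtain t where t: "t \<in> carrier R" "s \<otimes>\<^bsub>R\<^esub> \<sigma> g r = \<sigma> g t" by blast
      have "x \<otimes>\<^bsub>R\<^esub> s \<otimes>\<^bsub>R\<^esub> \<sigma> g r = x \<otimes>\<^bsub>R\<^esub> \<sigma> g t"
        using xR s r g t by (simp add: R.m_assoc)
      then show ?thesis using left_annD[OF x h t(1)] by simp
    qed
    moreover have "x \<otimes>\<^bsub>R\<^esub> s \<in> carrier R" using xR s by (rule R.m_closed)
    ultimately show ?thesis unfolding left_ann_def by blast
  qed
  then show ?thesis
    using L.left_closed L.additive_subgroup_axioms
    by (simp add: ideal_def ideal_axioms_def R.ring_axioms)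
qed

lemma left_ann_add:
  assumes "b \<in> carrier R" "b' \<in> carrier R" "g \<in> carrier G" "x \<in> left_ann g b" "x \<in> left_ann g b'"
  shows "x \<in> left_ann g (b \<oplus>\<^bsub>R\<^esub> b')"
  using assms by (simp add: left_ann_def action_add R.r_distr)

text \<open>The image of \<open>s\<close> under \<open>\<sigma> h\<close> is absorbed into
  \<open>r\<close>, which ranges over all of \<open>R\<close>.\<close>

lemma left_ann_mult_left:
  assumes b: "b \<in> carrier R" and s: "s \<in> carrier R" and g: "g \<in> carrier G" and x: "x \<in> left_ann g b"
  shows "x \<in> left_ann g (s \<otimes>\<^bsub>R\<^esub> b)"
proof -
  have xR: "x \<in> carrier R" using x left_ann_subset by blast
  have "x \<otimes>\<^bsub>R\<^esub> \<sigma> g r \<otimes>\<^bsub>R\<^esub> \<sigma> g (\<sigma> h (s \<otimes>\<^bsub>R\<^esub> b)) \<in> I"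
    if h: "h \<in> carrier G" and r: "r \<in> carrier R" for h r
  proof -
    have "x \<otimes>\<^bsub>R\<^esub> \<sigma> g (r \<otimes>\<^bsub>R\<^esub> \<sigma> h s) \<otimes>\<^bsub>R\<^esub> \<sigma> g (\<sigma> h b) \<in> I"
      using x h by (rule left_annD) (simp add: r s h)
    then show ?thesis using xR b s g h r by (simp add: action_times R.m_assoc)
  qed
  then show ?thesis using xR by (simp add: left_ann_def)
qed

lemma left_ann_mult_right:
  assumes b: "b \<in> carrier R" and s: "s \<in> carrier R" and g: "g \<in> carrier G" and x: "x \<in> left_ann g b"
  shows "x \<in> left_ann g (b \<otimes>\<^bsub>R\<^esub> s)"
proof -
  have xR: "x \<in> carrier R" using x left_ann_subset by blast
  have "x \<otimes>\<^bsub>R\<^esub> \<sigma> g r \<otimes>\<^bsub>R\<^esub> \<sigma> g (\<sigma> h (b \<otimes>\<^bsub>R\<^esub> s)) \<in> I"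
    if h: "h \<in> carrier G" and r: "r \<in> carrier R" for h r
  proof -
    have "x \<otimes>\<^bsub>R\<^esub> \<sigma> g r \<otimes>\<^bsub>R\<^esub> \<sigma> g (\<sigma> h b) \<otimes>\<^bsub>R\<^esub> \<sigma> g (\<sigma> h s) \<in> I"
      using left_annD[OF x h r] by (rule I.I_r_closed) (simp add: g h s)
    then show ?thesis using xR b s g h r by (simp add: action_times R.m_assoc)
  qed
  then show ?thesis using xR by (simp add: left_ann_def)
qed

text \<open>The composite of \<open>\<sigma> h\<close> and \<open>\<sigma> k\<close> is the action
  of the product up to the unit \<open>c h k\<close>. On one side this unit is absorbed into
  \<open>r\<close>; on the other it is cancelled modulo \<open>I\<close>.\<close>

lemma left_ann_action:
  assumes b: "b \<in> carrier R" and k: "k \<in> carrier G" and g: "g \<in> carrier G" and x: "x \<in> left_ann g b"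
  shows "x \<in> left_ann g (\<sigma> k b)"
proof -
  have xR: "x \<in> carrier R" using x left_ann_subset by blast
  have "x \<otimes>\<^bsub>R\<^esub> \<sigma> g r \<otimes>\<^bsub>R\<^esub> \<sigma> g (\<sigma> h (\<sigma> k b)) \<in> I"
    if h: "h \<in> carrier G" and r: "r \<in> carrier R" for h r
  proof -
    have u: "\<sigma> g (c h k) \<in> Units R" using g h k by (intro action_Units twist_unit)
    have "x \<otimes>\<^bsub>R\<^esub> \<sigma> g r \<otimes>\<^bsub>R\<^esub> \<sigma> g (\<sigma> h (\<sigma> k b)) \<otimes>\<^bsub>R\<^esub> \<sigma> g (c h k)
        = x \<otimes>\<^bsub>R\<^esub> \<sigma> g r \<otimes>\<^bsub>R\<^esub> \<sigma> g (\<sigma> h (\<sigma> k b) \<otimes>\<^bsub>R\<^esub> c h k)"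
      using xR b g h k r by (simp add: action_times R.m_assoc)
    also have "\<dots> = x \<otimes>\<^bsub>R\<^esub> \<sigma> g r \<otimes>\<^bsub>R\<^esub> \<sigma> g (c h k \<otimes>\<^bsub>R\<^esub> \<sigma> (h \<otimes>\<^bsub>G\<^esub> k) b)"
      using b h k by (simp add: action_mult)
    also have "\<dots> = x \<otimes>\<^bsub>R\<^esub> \<sigma> g (r \<otimes>\<^bsub>R\<^esub> c h k) \<otimes>\<^bsub>R\<^esub> \<sigma> g (\<sigma> (h \<otimes>\<^bsub>G\<^esub> k) b)"
      using xR b g h k r by (simp add: action_times R.m_assoc)
    also have "\<dots> \<in> I"
      using x by (rule left_annD) (simp_all add: r h k)
    finally show ?thesis
      using u xR b g h k r by (simp add: I.mult_unit_right_iff)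
  qed
  then show ?thesis using xR by (simp add: left_ann_def)
qed

lemma ideal_right_ann:
  assumes A: "A \<subseteq> carrier R" and g: "g \<in> carrier G"
  shows "ideal (right_ann g A) R"
proof (rule R.ideal_of_closed)
  have "x \<in> left_ann g \<zero>\<^bsub>R\<^esub>" if "x \<in> A" for x
    using A g that by (auto simp: left_ann_def)
  then show "\<zero>\<^bsub>R\<^esub> \<in> right_ann g A" by (simp add: right_ann_def)
qed (use g in \<open>auto simp: right_ann_def left_ann_add left_ann_mult_left left_ann_mult_right\<close>)

lemma G_stable_right_ann:
  assumes "g \<in> carrier G"
  shows "G_stable G \<sigma> (right_ann g A)"
  using assms by (auto simp: G_stable_def right_ann_def left_ann_action)

lemma mult_right_ann:
  assumes A: "A \<subseteq> carrier R" and g: "g \<in> carrier G"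
  shows "A \<cdot>\<^bsub>R\<^esub> (\<sigma> g ` right_ann g A) \<subseteq> I"
proof
  fix z assume "z \<in> A \<cdot>\<^bsub>R\<^esub> (\<sigma> g ` right_ann g A)"
  then show "z \<in> I"
  proof induction
    case (prod a z)
    then obtain y where y: "y \<in> carrier R" "a \<in> left_ann g y" "z = \<sigma> g y"
      by (auto simp: right_ann_def)
    \<comment> \<open>The defining property at \<open>r = 1\<close> and \<open>h\<close> the
      identity leaves exactly the product of \<open>a\<close> and
      \<open>\<sigma> g y\<close>.\<close>
    then have "a \<otimes>\<^bsub>R\<^esub> \<sigma> g \<one>\<^bsub>R\<^esub> \<otimes>\<^bsub>R\<^esub> \<sigma> g (\<sigma> \<one>\<^bsub>G\<^esub> y) \<in> I" by (intro left_annD) auto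
    moreover have "a \<in> carrier R" using prod A by blast
    ultimately show ?case using y g by (simp add: action_one)
  qed (rule I.a_closed)
qed

text \<open>The predicate \<open>Q\<close> stands for "left ideal" or "ideal", so that both versions
  of (3) imply (2) by one argument, applied to \<open>left_ann g b\<close> and its
  \<open>right_ann\<close>.\<close>

lemma skew_primeI:
  assumes Q: "\<And>g b. \<lbrakk>g \<in> carrier G; b \<in> carrier R\<rbrakk> \<Longrightarrow> Q (left_ann g b)"
    and prime: "\<And>A B g. \<lbrakk>Q A; ideal B R; G_stable G \<sigma> B; g \<in> carrier G; A \<cdot>\<^bsub>R\<^esub> (\<sigma> g ` B) \<subseteq> I\<rbrakk>
      \<Longrightarrow> A \<subseteq> I \<or> B \<subseteq> I"
  shows skew_prime
  unfolding skew_prime_def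
proof (intro ballI impI)
  fix a b g
  assume a: "a \<in> carrier R" and b: "b \<in> carrier R" and g: "g \<in> carrier G"
    and I: "\<forall>h\<in>carrier G. \<forall>r\<in>carrier R. a \<otimes>\<^bsub>R\<^esub> \<sigma> g r \<otimes>\<^bsub>R\<^esub> \<sigma> g (\<sigma> h b) \<in> I"
  let ?A = "left_ann g b"
  have "?A \<subseteq> I \<or> right_ann g ?A \<subseteq> I"
    using prime[OF Q[OF g b] ideal_right_ann G_stable_right_ann g mult_right_ann] left_ann_subset g
    by blast
  moreover have "a \<in> ?A" using a I by (simp add: left_ann_def)
  moreover have "b \<in> right_ann g ?A" using b by (simp add: right_ann_def)
  ultimately show "a \<in> I \<or> (\<forall>h\<in>carrier G. \<sigma> h b \<in> I)" using action_in_ideal by blast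
qed

end

text \<open>Properness is attached to the equivalence with primeness alone: for
  \<open>I = carrier R\<close> the other conditions hold trivially, while a prime ideal is proper by
  definition.\<close>

theorem proposition4p5:
  fixes R :: "('r, 'k) ring_scheme" and G :: "('g, 'm) monoid_scheme"
    and \<sigma> :: "'g \<Rightarrow> 'r \<Rightarrow> 'r" and c :: "'g \<Rightarrow> 'g \<Rightarrow> 'r" and I :: "'r set"
  assumes "unique_product_monoid G"
    and "crossed_system R G \<sigma> c"
    and "ideal I R"
    and "G_stable G \<sigma> I"
  shows "let
      cond1 = right_S_prime R G \<sigma> c I;
      cond2 = (\<forall>a\<in>carrier R. \<forall>b\<in>carrier R. \<forall>g\<in>carrier G.
        (\<forall>h\<in>carrier G. \<forall>r\<in>carrier R. a \<otimes>\<^bsub>R\<^esub> \<sigma> g r \<otimes>\<^bsub>R\<^esub> \<sigma> g (\<sigma> h b) \<in> I)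
          \<longrightarrow> a \<in> I \<or> (\<forall>h\<in>carrier G. \<sigma> h b \<in> I));
      cond3 = (\<forall>A B. left_ideal A R \<and> ideal B R \<and> G_stable G \<sigma> B
        \<and> (\<exists>g\<in>carrier G. A \<cdot>\<^bsub>R\<^esub> (\<sigma> g ` B) \<subseteq> I) \<longrightarrow> A \<subseteq> I \<or> B \<subseteq> I);
      cond3_two_sided = (\<forall>A B. ideal A R \<and> ideal B R \<and> G_stable G \<sigma> B
        \<and> (\<exists>g\<in>carrier G. A \<cdot>\<^bsub>R\<^esub> (\<sigma> g ` B) \<subseteq> I) \<longrightarrow> A \<subseteq> I \<or> B \<subseteq> I)
    in (I \<noteq> carrier R \<longrightarrow> (cond1 \<longleftrightarrow> cond2)) \<and> (cond2 \<longleftrightarrow> cond3) \<and>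
       (cring R \<or> pointwise_surjective R G \<sigma> \<longrightarrow> (cond2 \<longleftrightarrow> cond3_two_sided))"
proof -
  interpret stable_ideal R G \<sigma> c I
    using assms by (simp add: stable_ideal_def stable_ideal_axioms_def)
  have left: "left_ideal A R" if "ideal A R" for A
    using that by (simp add: ideal_def ideal_axioms_def left_ideal_def left_ideal_axioms_def)
  have c1: "right_S_prime R G \<sigma> c I \<longleftrightarrow> skew_prime" if "I \<noteq> carrier R"
    unfolding right_S_prime_def extended_ideal_eq
    using nc_prime_imp_skew_prime skew_prime_imp_nc_prime[OF assms(1) that] by blast
  have c3: "skew_prime \<longleftrightarrow> (\<forall>A B. left_ideal A R \<and> ideal B R \<and> G_stable G \<sigma> B
      \<and> (\<exists>g\<in>carrier G. A \<cdot>\<^bsub>R\<^esub> (\<sigma> g ` B) \<subseteq> I) \<longrightarrow> A \<subseteq> I \<or> B \<subseteq> I)" (is "_ \<longleftrightarrow> ?C3")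
  proof
    show ?C3 if skew_prime using skew_prime_imp_ideal_prime[OF that] by blast
    show skew_prime if ?C3
      by (rule skew_primeI[where Q = "\<lambda>A. left_ideal A R"]) (use that left_ideal_left_ann in blast)+
  qed
  have c3': "skew_prime \<longleftrightarrow> (\<forall>A B. ideal A R \<and> ideal B R \<and> G_stable G \<sigma> B
      \<and> (\<exists>g\<in>carrier G. A \<cdot>\<^bsub>R\<^esub> (\<sigma> g ` B) \<subseteq> I) \<longrightarrow> A \<subseteq> I \<or> B \<subseteq> I)" (is "_ \<longleftrightarrow> ?C3")
    if comm: "cring R \<or> pointwise_surjective R G \<sigma>"
  proof
    show ?C3 if skew_prime using skew_prime_imp_ideal_prime[OF that left] by blast
    show skew_prime if ?C3
      by (rule skew_primeI[where Q = "\<lambda>A. ideal A R"]) (use that ideal_left_ann[OF comm] in blast)+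
  qed
  show ?thesis
    unfolding Let_def
    using c1[unfolded skew_prime_def] c3[unfolded skew_prime_def] c3'[unfolded skew_prime_def]
    by blast
qed

end
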